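(* Let $p>2$ be a prime and let $\mathbb H=\overline{\mathbb F_p}((t^{\mathbb Q}))$ with its $t$-adic valuation $v$. Let $K$ be a subfield of $\mathbb H$ containing $\overline{\mathbb F_p}(t)$ which is perfect, Henselian (with respect to $v$) and has no finite limits. Let $\alpha,\theta,\eta\in\mathbb H$ satisfy $\alpha^p-\alpha=t^{-1}$, $\theta^p-\theta=\alpha$ and $\eta^p-\eta=\alpha^2$, and let $N=K(\theta,\eta)$. Then the (Galois) extension $(N/K,v)$ admits only one ramification ideal, and it is the maximal ideal of the valuation ring of $(N,v)$.
   Context: $\mathbb H$ is the Hahn series field with exponents in $\mathbb Q$ and coefficients in $\overline{\mathbb F_p}$ (well-ordered supports). A subfield $K$ of $\mathbb H$ has no finite limits if for every $a=\sum_\gamma c_\gamma t^\gamma\in K$ and every $\delta\in\mathbb R$ the set $\{\gamma<\delta\mid c_\gamma\ne0\}$ is finite. For a finite Galois extension $\mathcal E=(L/K,v)$ and $\sigma\in\mathrm{Gal}(L/K)$, $I_\sigma=\{c\in L\mid vc\ge v\left(\frac{\sigma b-b}{b}\right)\text{ for some }b\in L^*\}$; for a subgroup $H$ of $\mathrm{Gal}(L/K)$, $I_H=\bigcup_{\sigma\in H}I_\sigma$; $\mathrm{Ram}(\mathcal E)=\{I_H\mid H\text{ a subgroup of }\mathrm{Gal}(L/K),\ H\ne\{\mathrm{id}\}\}$. The ramification ideals of $\mathcal E$ are the elements of $\mathrm{Ram}(\mathcal E)$ contained in the maximal ideal $\mathcal M_L$ of the valuation ring of $(L,v)$. It is known that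 $N/K$ is Galois (of degree $p^3$). *)

theory Defs
  imports
    "HOL-Algebra.Algebra"
    "HOL-Algebra.Algebraic_Closure_Type"
    "HOL-Library.Extended"
    "HOL-Library.Groups_Big_Fun"
    "Berlekamp_Zassenhaus.Finite_Field"
begin

section \<open>Well-ordered sets of rationals\<close>

lemma wfp_on_less_iff:
  fixes A :: "rat set"
  shows "wfp_on A (<) \<longleftrightarrow> (\<forall>S\<subseteq>A. S \<noteq> {} \<longrightarrow> (\<exists>m\<in>S. \<forall>x\<in>S. m \<le> x))"
  unfolding wfp_on_iff_ex_minimal by (meson linorder_not_le subsetD)

lemma wfp_on_lessE:
  fixes A :: "rat set"
  assumes "wfp_on A (<)" "S \<subseteq> A" "S \<noteq> {}"
  obtains m where "m \<in> S" "\<And>x. x \<in> S \<Longrightarrow> m \<le> x"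
proof -
  have "\<exists>m\<in>S. \<forall>x\<in>S. m \<le> x" using assms by (simp add: wfp_on_less_iff)
  then show thesis using that by blast
qed

lemma wfp_on_less_Un:
  fixes A B :: "rat set"
  assumes A: "wfp_on A (<)" and B: "wfp_on B (<)"
  shows "wfp_on (A \<union> B) (<)"
  unfolding wfp_on_less_iff
proof (intro allI impI)
  fix S assume S: "S \<subseteq> A \<union> B" "S \<noteq> {}"
  show "\<exists>m\<in>S. \<forall>x\<in>S. m \<le> x"
  proof (cases "S \<inter> A = {} \<or> S \<inter> B = {}")
    case True
    then have "S \<subseteq> B \<or> S \<subseteq> A" using S by blast
    then show ?thesis using A B S unfolding wfp_on_less_iff by blast
  next
    case False
    obtain a where a: "a \<in> S \<inter> A" "\<And>x. x \<in> S \<inter> A \<Longrightarrow> a \<le> x"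
      by (rule wfp_on_lessE[OF A, of "S \<inter> A"]) (use False in auto)
    obtain b where b: "b \<in> S \<inter> B" "\<And>x. x \<in> S \<inter> B \<Longrightarrow> b \<le> x"
      by (rule wfp_on_lessE[OF B, of "S \<inter> B"]) (use False in auto)
    have "min a b \<in> S" using a b by (auto simp: min_def)
    moreover have "min a b \<le> x" if "x \<in> S" for x
      using a(2)[of x] b(2)[of x] that S(1) by (auto simp: min_le_iff_disj)
    ultimately show ?thesis by blast
  qed
qed

lemma wfp_on_less_finite_Union:
  fixes A :: "nat \<Rightarrow> rat set"
  assumes "\<And>n. wfp_on (A n) (<)"
  shows "wfp_on (\<Union>n<N. A n) (<)"
proof (induction N)
  case 0
  show ?case by (simp add: wfp_on_less_iff)
next
  case (Suc N)
  then show ?case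
    using wfp_on_less_Un[OF assms[of N] Suc] by (simp add: lessThan_Suc)
qed

lemma wfp_on_less_plus:
  fixes A B :: "rat set"
  assumes A: "wfp_on A (<)" and B: "wfp_on B (<)"
  shows "wfp_on {a + b |a b. a \<in> A \<and> b \<in> B} (<)"
proof -
  have step: "\<exists>m\<in>S. \<forall>x\<in>S. m \<le> x"
    if S: "S \<subseteq> {a + b |a b. a \<in> A \<and> b \<in> B \<and> Q a}" "S \<noteq> {}"
      and IH: "\<And>a1 T. \<lbrakk>a1 \<in> A; Q a1; T \<subseteq> {a + b |a b. a \<in> A \<and> b \<in> B \<and> a < a1}; T \<noteq> {}\<rbrakk>
                 \<Longrightarrow> \<exists>m\<in>T. \<forall>x\<in>T. m \<le> x" for S Q
  proof -
    let ?B = "{b \<in> B. \<exists>a\<in>A. Q a \<and> a + b \<in> S}"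
    have ne: "?B \<noteq> {}" using S by blast
    obtain b where b: "b \<in> ?B" "\<And>x. x \<in> ?B \<Longrightarrow> b \<le> x"
      by (rule wfp_on_lessE[OF B _ ne]) auto
    then obtain a1 where a1: "a1 \<in> A" "Q a1" "a1 + b \<in> S" by blast
    let ?T = "{s \<in> S. s < a1 + b}"
    show ?thesis
    proof (cases "?T = {}")
      case True
      then have "a1 + b \<le> x" if "x \<in> S" for x using that by (auto simp: not_less)
      then show ?thesis using a1(3) by (intro bexI[of _ "a1 + b"] ballI)
    next
      case False
      have "?T \<subseteq> {a + b |a b. a \<in> A \<and> b \<in> B \<and> a < a1}"
      proof
        fix s assume s: "s \<in> ?T"
        then obtain a' b' where ab: "s = a' + b'" "a' \<in> A" "b' \<in> B" "Q a'" using S by blast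
        then have "b \<le> b'" using b(2)[of b'] s by blast
        then have "a' < a1" using s ab by auto
        then show "s \<in> {a + b |a b. a \<in> A \<and> b \<in> B \<and> a < a1}" using ab by blast
      qed
      then obtain m where "m \<in> ?T" "\<forall>x\<in>?T. m \<le> x" using IH[OF a1(1,2) _ False] by blast
      then have "m \<le> x" if "x \<in> S" for x
        using that by (cases "x < a1 + b") auto
      then show ?thesis using \<open>m \<in> ?T\<close> by (intro bexI[of _ m] ballI) auto
    qed
  qed
  have below: "\<exists>m\<in>T. \<forall>x\<in>T. m \<le> x"
    if "a1 \<in> A" "T \<subseteq> {a + b |a b. a \<in> A \<and> b \<in> B \<and> a < a1}" "T \<noteq> {}" for a1 T
    using that
  proof (induction a1 arbitrary: T rule: wfp_on_induct[OF A])
    case 1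
    then show ?case by (simp add: that(1))
  next
    case (2 x)
    show ?case
      by (rule step[of T "\<lambda>a. a < x"]) (use 2 in blast)+
  qed
  show ?thesis
    unfolding wfp_on_less_iff
  proof (intro allI impI)
    fix S assume "S \<subseteq> {a + b |a b. a \<in> A \<and> b \<in> B}" "S \<noteq> {}"
    then show "\<exists>m\<in>S. \<forall>x\<in>S. m \<le> x"
      using step[of S "\<lambda>_. True"] below by simp
  qed
qed

lemma finite_wfp_on_both:
  fixes A :: "rat set"
  assumes l: "wfp_on A (<)" and g: "\<And>S. S \<subseteq> A \<Longrightarrow> S \<noteq> {} \<Longrightarrow> \<exists>m\<in>S. \<forall>x\<in>S. x \<le> m"
  shows "finite A"
proof -
  have fin: "finite S" if sub: "S \<subseteq> A" and "\<And>a. a \<in> S \<Longrightarrow> finite {x \<in> A. x < a}" for S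
  proof (cases "S = {}")
    case False
    then obtain m where m: "m \<in> S" "\<forall>x\<in>S. x \<le> m" using g[OF sub False] by blast
    then have "S \<subseteq> insert m {x \<in> A. x < m}" using that(1) by (auto simp: order_le_less)
    then show ?thesis using that(2)[OF m(1)] by (meson finite.insertI finite_subset)
  qed auto
  have "{a \<in> A. infinite {x \<in> A. x < a}} = {}"
  proof (rule ccontr)
    assume ne: "\<not> ?thesis"
    obtain a where a: "a \<in> A" "infinite {x \<in> A. x < a}"
      and least: "\<And>b. b \<in> A \<Longrightarrow> infinite {x \<in> A. x < b} \<Longrightarrow> a \<le> b"
      by (rule wfp_on_lessE[OF l _ ne]) auto
    have "finite {x \<in> A. x < a}"
    proof (rule fin)
      show "finite {x \<in> A. x < b}" if "b \<in> {x \<in> A. x < a}" for b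
      proof (rule ccontr)
        assume "infinite {x \<in> A. x < b}"
        then have "a \<le> b" using least that by simp
        then show False using that by simp
      qed
    qed simp
    with a show False by simp
  qed
  then have "finite {x \<in> A. x < a}" if "a \<in> A" for a using that by blast
  then show ?thesis by (rule fin[OF subset_refl])
qed

lemma finite_antidiagonal:
  fixes A B :: "rat set"
  assumes A: "wfp_on A (<)" and B: "wfp_on B (<)"
  shows "finite {a. a \<in> A \<and> q - a \<in> B}"
proof (rule finite_wfp_on_both)
  show "wfp_on {a. a \<in> A \<and> q - a \<in> B} (<)"
    by (rule wfp_on_subset[OF A]) auto
next
  fix S assume S: "S \<subseteq> {a. a \<in> A \<and> q - a \<in> B}" "S \<noteq> {}"
  obtain m where m: "m \<in> (\<lambda>a. q - a) ` S" "\<And>x. x \<in> (\<lambda>a. q - a) ` S \<Longrightarrow> m \<le> x"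
    by (rule wfp_on_lessE[OF B, of "(\<lambda>a. q - a) ` S"]) (use S in auto)
  then obtain a where "a \<in> S" "m = q - a" by blast
  moreover from this have "x \<le> a" if "x \<in> S" for x using m(2)[of "q - x"] that by auto
  ultimately show "\<exists>m\<in>S. \<forall>x\<in>S. x \<le> m" by blast
qed


section \<open>Hahn series with rational exponents\<close>

typedef (overloaded) 'a hahn = "{f :: rat \<Rightarrow> 'a::zero. wfp_on {q. f q \<noteq> 0} (<)}"
  morphisms hcoeff Abs_hahn
  by (rule exI[of _ "\<lambda>_. 0"]) (simp add: wfp_on_less_iff)

setup_lifting type_definition_hahn

definition hsupp :: "'a::zero hahn \<Rightarrow> rat set"
  where "hsupp f = {q. hcoeff f q \<noteq> 0}"

lemma wfp_on_hsupp: "wfp_on (hsupp f) (<)"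
  using hcoeff[of f] by (simp add: hsupp_def)

lemma hahn_eqI: "(\<And>q. hcoeff f q = hcoeff g q) \<Longrightarrow> f = g"
  by (simp add: hcoeff_inject[symmetric] ext)

instantiation hahn :: (zero) zero
begin
lift_definition zero_hahn :: "'a hahn" is "\<lambda>_. 0"
  by (simp add: wfp_on_less_iff)
instance ..
end

lemma hcoeff_0 [simp]: "hcoeff 0 q = 0"
  by transfer simp

lift_definition hmonom :: "'a::zero \<Rightarrow> rat \<Rightarrow> 'a hahn" is "\<lambda>c r q. if q = r then c else 0"
  by (auto simp: wfp_on_less_iff)

lemma hcoeff_hmonom: "hcoeff (hmonom c r) q = (if q = r then c else 0)"
  by transfer simp

abbreviation hconst :: "'a::zero \<Rightarrow> 'a hahn"
  where "hconst c \<equiv> hmonom c 0"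

abbreviation hvar :: "'a::{zero,one} hahn"
  where "hvar \<equiv> hmonom 1 1"

instantiation hahn :: (comm_ring_1) comm_ring_1
begin

lift_definition one_hahn :: "'a hahn" is "\<lambda>q. if q = 0 then 1 else 0"
  by (auto simp: wfp_on_less_iff)

lift_definition uminus_hahn :: "'a hahn \<Rightarrow> 'a hahn" is "\<lambda>f q. - f q"
  by simp

lift_definition plus_hahn :: "'a hahn \<Rightarrow> 'a hahn \<Rightarrow> 'a hahn" is "\<lambda>f g q. f q + g q"
  by (erule (1) wfp_on_subset[OF wfp_on_less_Un]) auto

lift_definition minus_hahn :: "'a hahn \<Rightarrow> 'a hahn \<Rightarrow> 'a hahn" is "\<lambda>f g q. f q - g q"
  by (erule (1) wfp_on_subset[OF wfp_on_less_Un]) auto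

text \<open>Only finitely many terms of the sum are nonzero, by \<open>finite_antidiagonal\<close>.\<close>
lift_definition times_hahn :: "'a hahn \<Rightarrow> 'a hahn \<Rightarrow> 'a hahn"
  is "\<lambda>f g q. Sum_any (\<lambda>a. f a * g (q - a))"
proof -
  fix f g :: "rat \<Rightarrow> 'a"
  assume *: "wfp_on {q. f q \<noteq> 0} (<)" "wfp_on {q. g q \<noteq> 0} (<)"
  have "\<exists>a b. q = a + b \<and> f a \<noteq> 0 \<and> g b \<noteq> 0" if nz: "Sum_any (\<lambda>a. f a * g (q - a)) \<noteq> 0" for q
  proof -
    obtain a where "f a * g (q - a) \<noteq> 0"
      using nz by (rule Sum_any.not_neutral_obtains_not_neutral)
    then have "f a \<noteq> 0" "g (q - a) \<noteq> 0" by auto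
    then show ?thesis by (intro exI[of _ a] exI[of _ "q - a"]) auto
  qed
  then show "wfp_on {q. Sum_any (\<lambda>a. f a * g (q - a)) \<noteq> 0} (<)"
    by (intro wfp_on_subset[OF wfp_on_less_plus[OF *]]) auto
qed

lemma hcoeff_1: "hcoeff 1 q = (if q = 0 then 1 else 0)"
  by transfer simp

lemma hcoeff_add [simp]: "hcoeff (f + g) q = hcoeff f q + hcoeff g q"
  by transfer simp

lemma hcoeff_diff [simp]: "hcoeff (f - g) q = hcoeff f q - hcoeff g q"
  by transfer simp

lemma hcoeff_uminus [simp]: "hcoeff (- f) q = - hcoeff f q"
  by transfer simp

lemma hcoeff_mult: "hcoeff (f * g) q = Sum_any (\<lambda>a. hcoeff f a * hcoeff g (q - a))"
  by transfer simp

lemma finite_hmult: "finite {a. hcoeff (f :: 'a hahn) a * hcoeff g (q - a) \<noteq> 0}"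
  by (rule finite_subset[OF _ finite_antidiagonal[OF wfp_on_hsupp[of f] wfp_on_hsupp[of g], of q]])
     (auto simp: hsupp_def)

lemma hmult_commute: "f * g = g * (f :: 'a hahn)"
proof (rule hahn_eqI)
  fix q :: rat
  have "bij (\<lambda>a. q - a)" by (rule o_bij[of "\<lambda>a. q - a"]) (auto simp: fun_eq_iff)
  then show "hcoeff (f * g) q = hcoeff (g * f) q"
    unfolding hcoeff_mult
    by (intro Sum_any.reindex_cong[of "\<lambda>a. q - a"]) (auto simp: fun_eq_iff bij_def mult.commute)
qed

lemma hmult_assoc: "(f * g) * h = f * (g * (h :: 'a hahn))"
proof (rule hahn_eqI)
  fix q :: rat
  have fin1: "finite {a. hcoeff (f :: 'a hahn) a * hcoeff g (c - a) * hcoeff h (q - c) \<noteq> 0}" for c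
    by (rule finite_subset[OF _ finite_hmult[of f g c]]) auto
  define P where "P = {c. c \<in> {a + b |a b. a \<in> hsupp f \<and> b \<in> hsupp g} \<and> q - c \<in> hsupp h}"
  have P: "finite P"
    unfolding P_def by (intro finite_antidiagonal wfp_on_less_plus wfp_on_hsupp)
  define D where "D = (\<Union>c\<in>P. {a. a \<in> hsupp f \<and> c - a \<in> hsupp g})"
  have D: "finite D"
    unfolding D_def by (intro finite_UN_I P finite_antidiagonal wfp_on_hsupp)
  have nz: "c \<in> P \<and> a \<in> D" if "hcoeff f a * hcoeff g (c - a) * hcoeff h (q - c) \<noteq> 0" for a c
  proof -
    have *: "a \<in> hsupp f" "c - a \<in> hsupp g" "q - c \<in> hsupp h"
      using that by (auto simp: hsupp_def)
    then have "\<exists>a b. c = a + b \<and> a \<in> hsupp f \<and> b \<in> hsupp g"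
      by (intro exI[of _ a] exI[of _ "c - a"]) simp
    then have "c \<in> P"
      using *(3) unfolding P_def by blast
    then show ?thesis using * by (auto simp: D_def)
  qed
  have "hcoeff ((f * g) * h) q
      = (Sum_any (\<lambda>c. (Sum_any (\<lambda>a. hcoeff f a * hcoeff g (c - a))) * hcoeff h (q - c)))"
    by (simp add: hcoeff_mult)
  also have "\<dots> = (Sum_any (\<lambda>c. Sum_any (\<lambda>a. hcoeff f a * hcoeff g (c - a) * hcoeff h (q - c))))"
    by (simp add: Sum_any_left_distrib[OF finite_hmult])
  also have "\<dots> = (Sum_any (\<lambda>a. Sum_any (\<lambda>c. hcoeff f a * hcoeff g (c - a) * hcoeff h (q - c))))"
    by (rule Sum_any.swap[of "P \<times> D"]) (use P D nz in auto)
  also have "\<dots> = (Sum_any (\<lambda>a. Sum_any (\<lambda>b. hcoeff f a * (hcoeff g b * hcoeff h (q - a - b)))))"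
  proof (rule Sum_any.cong)
    fix a :: rat
    have "bij (\<lambda>b. a + b)" by (rule o_bij[of "\<lambda>b. b - a"]) (auto simp: fun_eq_iff)
    then show "(Sum_any (\<lambda>c. hcoeff f a * hcoeff g (c - a) * hcoeff h (q - c)))
        = (Sum_any (\<lambda>b. hcoeff f a * (hcoeff g b * hcoeff h (q - a - b))))"
      by (intro Sum_any.reindex_cong[of "\<lambda>b. a + b"])
         (auto simp: fun_eq_iff bij_def mult.assoc algebra_simps)
  qed
  also have "\<dots> = (Sum_any (\<lambda>a. hcoeff f a * (Sum_any (\<lambda>b. hcoeff g b * hcoeff h (q - a - b)))))"
    by (simp add: Sum_any_right_distrib[OF finite_hmult])
  also have "\<dots> = hcoeff (f * (g * h)) q"
    by (simp add: hcoeff_mult)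
  finally show "hcoeff ((f * g) * h) q = hcoeff (f * (g * h)) q" .
qed

lemma hmult_1: "1 * f = (f :: 'a hahn)"
proof (rule hahn_eqI)
  fix q :: rat
  have "hcoeff (1 * f) q = (Sum_any (\<lambda>a::rat. if a = 0 then hcoeff f q else 0))"
    unfolding hcoeff_mult by (intro Sum_any.cong) (simp add: hcoeff_1)
  also have "\<dots> = hcoeff f q"
    by simp
  finally show "hcoeff (1 * f) q = hcoeff f q" .
qed

lemma hmult_distrib: "(f + g) * h = f * h + g * (h :: 'a hahn)"
proof (rule hahn_eqI)
  fix q :: rat
  show "hcoeff ((f + g) * h) q = hcoeff (f * h + g * h) q"
    by (simp add: hcoeff_mult distrib_right Sum_any.distrib[OF finite_hmult finite_hmult])
qed

instance
proof
  fix f g h :: "'a hahn"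
  show "(0::'a hahn) \<noteq> 1"
    by (metis hcoeff_0 hcoeff_1 zero_neq_one)
qed (use hmult_commute hmult_assoc hmult_1 hmult_distrib in \<open>auto intro!: hahn_eqI\<close>)

end

subsection \<open>Inverses\<close>

lemma hcoeff_hmonom_mult:
  "hcoeff (hmonom c r * f) q = (c :: 'a::comm_ring_1) * hcoeff f (q - r)"
proof -
  have "hcoeff (hmonom c r * f) q = (Sum_any (\<lambda>a. if a = r then c * hcoeff f (q - r) else 0))"
    unfolding hcoeff_mult by (rule Sum_any.cong) (auto simp: hcoeff_hmonom)
  then show ?thesis by simp
qed

lemma hcoeff_mult_bound:
  fixes f g :: "'a::comm_ring_1 hahn"
  assumes "\<And>x. x \<in> hsupp f \<Longrightarrow> a \<le> x" "\<And>x. x \<in> hsupp g \<Longrightarrow> b \<le> x" "x \<in> hsupp (f * g)"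
  shows "a + b \<le> x"
proof -
  obtain y where "hcoeff f y * hcoeff g (x - y) \<noteq> 0"
    using assms(3) unfolding hsupp_def hcoeff_mult
    by (metis (mono_tags, lifting) Sum_any.not_neutral_obtains_not_neutral mem_Collect_eq)
  then have "y \<in> hsupp f" "x - y \<in> hsupp g" by (auto simp: hsupp_def)
  then have "a \<le> y" "b \<le> x - y" using assms by auto
  then show ?thesis by simp
qed

lemma hahn_one_minus_invertible:
  fixes e :: "'a::comm_ring_1 hahn"
  assumes pos: "\<And>x. x \<in> hsupp e \<Longrightarrow> 0 < x"
  shows "\<exists>g. (1 - e) * g = 1"
proof -
  obtain d where d: "d > 0" "\<And>x. x \<in> hsupp e \<Longrightarrow> d \<le> x"
  proof (cases "hsupp e = {}")
    case True
    then show ?thesis using that[of 1] by simp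
  next
    case False
    then show ?thesis using wfp_on_lessE[OF wfp_on_hsupp[of e] subset_refl] pos that by metis
  qed
  have pw: "of_nat n * d \<le> x" if "x \<in> hsupp (e ^ n)" for n x
    using that
  proof (induction n arbitrary: x)
    case 0
    then show ?case by (auto simp: hsupp_def hcoeff_1 split: if_splits)
  next
    case (Suc n)
    then have "d + of_nat n * d \<le> x"
      using hcoeff_mult_bound[of e d "e ^ n" "of_nat n * d" x] d(2) by simp
    then show ?case by (simp add: algebra_simps)
  qed
  define N where "N q = Suc (nat \<lceil>q / d\<rceil>)" for q
  have N: "q < of_nat n * d" if "N q \<le> n" for q n
  proof -
    have "q / d \<le> of_int \<lceil>q / d\<rceil>" by (rule le_of_int_ceiling)
    also have "\<dots> \<le> of_int (int (nat \<lceil>q / d\<rceil>))" by (simp only: of_int_le_iff)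
    also have "\<dots> = of_nat (nat \<lceil>q / d\<rceil>)" by simp
    also have "\<dots> < of_nat n" using that unfolding N_def by simp
    finally show ?thesis using d(1) by (simp add: field_simps)
  qed
  have N0: "hcoeff (e ^ n) q = 0" if "N q \<le> n" for q n
    using N[OF that] pw[of q n] by (force simp: hsupp_def)
  have Nmono: "N q \<le> N r" if "q \<le> r" for q r
    using that d(1) by (auto simp: N_def intro!: nat_mono ceiling_mono divide_right_mono)
  define G where "G q = (\<Sum>n<N q. hcoeff (e ^ n) q)" for q
  have G: "G q = (\<Sum>n<M. hcoeff (e ^ n) q)" if "N q \<le> M" for q M
    unfolding G_def using that N0 by (intro sum.mono_neutral_left) auto
  have "wfp_on {q. G q \<noteq> 0} (<)"
    unfolding wfp_on_less_iff
  proof (intro allI impI)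
    fix S assume S: "S \<subseteq> {q. G q \<noteq> 0}" "S \<noteq> {}"
    then obtain s where s: "s \<in> S" by blast
    let ?T = "{x \<in> S. x \<le> s}"
    have "?T \<subseteq> (\<Union>n<N s. hsupp (e ^ n))"
    proof
      fix x assume x: "x \<in> ?T"
      then have "(\<Sum>n<N s. hcoeff (e ^ n) x) \<noteq> 0" using G[of x "N s"] Nmono[of x s] S by auto
      then show "x \<in> (\<Union>n<N s. hsupp (e ^ n))"
        by (auto simp: hsupp_def elim: sum.not_neutral_contains_not_neutral)
    qed
    then obtain m where "m \<in> ?T" "\<And>x. x \<in> ?T \<Longrightarrow> m \<le> x"
      using wfp_on_lessE[OF wfp_on_less_finite_Union[of "\<lambda>n. hsupp (e ^ n)"], of ?T] wfp_on_hsupp s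
      by (metis (mono_tags, lifting) empty_iff mem_Collect_eq order_refl)
    then show "\<exists>m\<in>S. \<forall>x\<in>S. m \<le> x"
      by (metis (mono_tags, lifting) linorder_le_cases mem_Collect_eq order_trans)
  qed
  then have g: "hcoeff (Abs_hahn G) q = G q" for q
    by (simp add: Abs_hahn_inverse)
  have "(1 - e) * Abs_hahn G = 1"
  proof (rule hahn_eqI)
    fix q :: rat
    define g' where "g' = (\<Sum>n<N q. e ^ n)"
    have coeff_sum: "hcoeff (\<Sum>n<M. e ^ n) r = (\<Sum>n<M. hcoeff (e ^ n) r)" for M r
      by (induction M) auto
    have eq: "hcoeff (Abs_hahn G) r = hcoeff g' r" if "r \<le> q" for r
      using G[OF Nmono[OF that]] by (simp add: g g'_def coeff_sum)
    have low: "hcoeff (1 - e) a = 0" if "a < 0" for a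
      using pos[of a] that by (auto simp: hsupp_def hcoeff_1)
    have "hcoeff ((1 - e) * Abs_hahn G) q = hcoeff ((1 - e) * g') q"
      unfolding hcoeff_mult
    proof (rule Sum_any.cong)
      fix a
      show "hcoeff (1 - e) a * hcoeff (Abs_hahn G) (q - a) = hcoeff (1 - e) a * hcoeff g' (q - a)"
        using low[of a] eq[of "q - a"] by (cases "a < 0") auto
    qed
    also have "(1 - e) * g' = 1 - e ^ N q"
      unfolding g'_def by (simp add: one_diff_power_eq)
    also have "hcoeff (1 - e ^ N q) q = hcoeff 1 q"
      using N0[of q "N q"] by simp
    finally show "hcoeff ((1 - e) * Abs_hahn G) q = hcoeff 1 q" .
  qed
  then show ?thesis by blast
qed

lemma hahn_ex_inverse:
  fixes f :: "'a::field hahn"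
  assumes "f \<noteq> 0"
  shows "\<exists>g. f * g = 1"
proof -
  have "hsupp f \<noteq> {}" using assms by (auto simp: hsupp_def intro: hahn_eqI)
  then obtain m where m: "m \<in> hsupp f" "\<And>x. x \<in> hsupp f \<Longrightarrow> m \<le> x"
    using wfp_on_lessE[OF wfp_on_hsupp[of f] subset_refl] by metis
  define u where "u = hmonom (inverse (hcoeff f m)) (- m)"
  define e where "e = 1 - u * f"
  have nz: "hcoeff f m \<noteq> 0" using m by (simp add: hsupp_def)
  have "0 < x" if "x \<in> hsupp e" for x
  proof -
    have ne: "hcoeff e x \<noteq> 0" using that by (simp add: hsupp_def)
    have *: "hcoeff e x = hcoeff 1 x - inverse (hcoeff f m) * hcoeff f (x + m)"
      by (simp add: e_def u_def hcoeff_hmonom_mult)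
    have "x \<noteq> 0" using ne * nz by (auto simp: hcoeff_1)
    then have "x + m \<in> hsupp f" using ne * by (auto simp: hcoeff_1 hsupp_def)
    then show ?thesis using m(2)[of "x + m"] \<open>x \<noteq> 0\<close> by auto
  qed
  then obtain g where "(1 - e) * g = 1" using hahn_one_minus_invertible by blast
  then have "f * (u * g) = 1" by (simp add: e_def algebra_simps)
  then show ?thesis by blast
qed

instantiation hahn :: (field) inverse
begin

definition inverse_hahn :: "'a hahn \<Rightarrow> 'a hahn"
  where "inverse (f :: 'a hahn) = (if f = 0 then 0 else THE g. f * g = 1)"

definition divide_hahn :: "'a hahn \<Rightarrow> 'a hahn \<Rightarrow> 'a hahn"
  where "f div (g :: 'a hahn) = f * inverse g"

instance ..

end

instance hahn :: (field) field
proof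
  fix f g :: "'a hahn"
  show "inverse (0 :: 'a hahn) = 0" by (simp add: inverse_hahn_def)
  show "f div g = f * inverse g" by (simp add: divide_hahn_def)
  assume nz: "f \<noteq> 0"
  have "\<exists>!g. f * g = 1"
  proof (rule ex_ex1I)
    show "\<exists>g. f * g = 1" by (rule hahn_ex_inverse[OF nz])
    fix g h assume "f * g = 1" "f * h = 1"
    then show "g = h" by (metis mult.assoc mult.commute mult_1)
  qed
  then have "f * (THE g. f * g = 1) = 1" by (rule theI')
  then show "inverse f * f = 1" using nz by (simp add: inverse_hahn_def mult.commute)
qed


lemma hcoeff_of_nat: "hcoeff (of_nat n :: 'a::comm_ring_1 hahn) q = (if q = 0 then of_nat n else 0)"
  by (induction n) (auto simp: hcoeff_1)

lemma CHAR_hahn [simp]: "CHAR('a::comm_ring_1 hahn) = CHAR('a)"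
proof (rule CHAR_eqI)
  show "of_nat CHAR('a) = (0 :: 'a hahn)"
    by (rule hahn_eqI) (simp add: hcoeff_of_nat)
  fix n assume "of_nat n = (0 :: 'a hahn)"
  then have "of_nat n = (0 :: 'a)" using hcoeff_of_nat[of n 0, where 'a = 'a] by simp
  then show "CHAR('a) dvd n" by (simp add: of_nat_eq_0_iff_char_dvd)
qed

lemma CHAR_hahn_alg_closure_mod_ring:
  "CHAR('p::prime_card mod_ring alg_closure hahn) = CARD('p)"
  by simp


section \<open>Valued fields\<close>

definition hval :: "'a::zero hahn \<Rightarrow> rat extended"
  where "hval f = (if f = 0 then Pinf else Fin (LEAST q. hcoeff f q \<noteq> 0))"

lemma hval_eqI:
  assumes "hcoeff f m \<noteq> 0" "\<And>q. hcoeff f q \<noteq> 0 \<Longrightarrow> m \<le> q"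
  shows "hval f = Fin m"
  using assms by (auto simp: hval_def intro: Least_equality)

lemma hval_obtain:
  assumes "f \<noteq> 0"
  obtains m where "hval f = Fin m" "hcoeff f m \<noteq> 0" "\<And>q. hcoeff f q \<noteq> 0 \<Longrightarrow> m \<le> q"
proof -
  have "hsupp f \<noteq> {}" using assms by (auto simp: hsupp_def intro: hahn_eqI)
  then obtain m where m: "m \<in> hsupp f" "\<And>x. x \<in> hsupp f \<Longrightarrow> m \<le> x"
    using wfp_on_lessE[OF wfp_on_hsupp[of f] subset_refl] by metis
  then have "hval f = Fin m" by (intro hval_eqI) (simp_all add: hsupp_def)
  with m show thesis by (intro that) (simp_all add: hsupp_def)
qed

definition no_finite_limits :: "'a::zero hahn set \<Rightarrow> bool"
  where "no_finite_limits K \<longleftrightarrow>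
    (\<forall>a\<in>K. \<forall>\<delta>::real. finite {\<gamma>. real_of_rat \<gamma> < \<delta> \<and> hcoeff a \<gamma> \<noteq> 0})"

text \<open>
  From here on, fields are subsets of an ambient field type \<open>'a\<close>, valued by the restriction
  of a map \<open>v\<close> on \<open>'a\<close>.
\<close>

definition valuation_ring :: "('a \<Rightarrow> 'v::linordered_ab_group_add extended) \<Rightarrow> 'a set \<Rightarrow> 'a set"
  where "valuation_ring v K = {x \<in> K. 0 \<le> v x}"

definition valuation_ideal :: "('a \<Rightarrow> 'v::linordered_ab_group_add extended) \<Rightarrow> 'a set \<Rightarrow> 'a set"
  where "valuation_ideal v K = {x \<in> K. 0 < v x}"

text \<open>Henselian in the sense of Hensel's Lemma.\<close>
definition henselian :: "('a::field \<Rightarrow> 'v::linordered_ab_group_add extended) \<Rightarrow> 'a set \<Rightarrow> bool"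
  where "henselian v K \<longleftrightarrow>
    (\<forall>f::'a poly. \<forall>b.
       (\<forall>i. coeff f i \<in> valuation_ring v K) \<longrightarrow> b \<in> valuation_ring v K \<longrightarrow>
       0 < v (poly f b) \<longrightarrow> v (poly (pderiv f) b) = 0 \<longrightarrow>
       (\<exists>a \<in> valuation_ring v K. poly f a = 0 \<and> 0 < v (a - b)))"

definition perfect_subfield :: "'a::field set \<Rightarrow> bool"
  where "perfect_subfield K \<longleftrightarrow> CHAR('a) = 0 \<or> (\<forall>x\<in>K. \<exists>y\<in>K. y ^ CHAR('a) = x)"


section \<open>Ramification ideals\<close>

text \<open>
  As in \<open>auto\<close> and \<open>AutoGroup\<close>, automorphisms are extensional (undefined outside \<open>L\<close>),
  so that distinct elements of \<open>gal L K\<close> are distinct as maps on \<open>L\<close>.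
  The notions below are intended for finite Galois extensions \<open>L\<close> of \<open>K\<close>.
\<close>
definition gal :: "'a::field set \<Rightarrow> 'a set \<Rightarrow> ('a \<Rightarrow> 'a) set"
  where "gal L K =
    {\<sigma> \<in> Bij L. \<sigma> \<in> Ring.ring_hom (ring_of_type_algebra\<lparr>carrier := L\<rparr>) (ring_of_type_algebra\<lparr>carrier := L\<rparr>)
       \<and> (\<forall>x\<in>K. \<sigma> x = x)}"

definition gal_group :: "'a::field set \<Rightarrow> 'a set \<Rightarrow> ('a \<Rightarrow> 'a) monoid"
  where "gal_group L K = (BijGroup L)\<lparr>carrier := gal L K\<rparr>"

definition ram_elem :: "('a::field \<Rightarrow> 'v::linordered_ab_group_add extended) \<Rightarrow> 'a set \<Rightarrow> ('a \<Rightarrow> 'a) \<Rightarrow> 'a set"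
  where "ram_elem v L \<sigma> = {c \<in> L. \<exists>b \<in> L - {0}. v c \<ge> v ((\<sigma> b - b) / b)}"

definition ram_subgroup :: "('a::field \<Rightarrow> 'v::linordered_ab_group_add extended) \<Rightarrow> 'a set \<Rightarrow> ('a \<Rightarrow> 'a) set \<Rightarrow> 'a set"
  where "ram_subgroup v L H = (\<Union>\<sigma>\<in>H. ram_elem v L \<sigma>)"

definition Ram :: "('a::field \<Rightarrow> 'v::linordered_ab_group_add extended) \<Rightarrow> 'a set \<Rightarrow> 'a set \<Rightarrow> 'a set set"
  where "Ram v L K =
    {ram_subgroup v L H |H. subgroup H (gal_group L K) \<and> H \<noteq> {\<one>\<^bsub>gal_group L K\<^esub>}}"

definition ramification_ideals :: "('a::field \<Rightarrow> 'v::linordered_ab_group_add extended) \<Rightarrow> 'a set \<Rightarrow> 'a set \<Rightarrow> 'a set set"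
  where "ramification_ideals v L K = {I \<in> Ram v L K. I \<subseteq> valuation_ideal v L}"

end

theory Submission
  imports Defs
begin

text \<open>
  If \<open>\<sigma>\<close> moves \<open>\<alpha>\<close>, \<open>\<theta>\<close> or \<open>\<eta>\<close>, let \<open>x\<close> be the first of these that it moves. Then
  \<open>\<sigma> x - x\<close> is a nonzero element of the prime field while \<open>v x < 0\<close>. As \<open>N\<close> is perfect, \<open>x\<close> has a
  root \<open>z\<close> of order \<open>p\<^sup>n\<close> in \<open>N\<close>, and \<open>v ((\<sigma> z - z) / z) = - v x / p\<^sup>n\<close> is arbitrarily small;
  so \<open>I\<^sub>\<sigma>\<close> contains the maximal ideal.

  Conversely \<open>v (\<sigma> b - b) > v b\<close> for all \<open>b\<close>. As \<open>K\<close> is Henselian, the valuation is invariant under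
  the Galois group, whose fixed field is \<open>K\<close> since automorphisms extend along the tower of
  Artin--Schreier extensions \<open>K \<subseteq> K(\<alpha>) \<subseteq> K(\<theta>) \<subseteq> N\<close>. The residue of \<open>\<sigma> b / b\<close> is then a root of
  unity of \<open>p\<close>-power order, i.e. \<open>1\<close>. That the group is nontrivial follows from \<open>\<alpha> \<notin> K\<close>, as \<open>K\<close> has
  no finite limits.
\<close>

subsection \<open>Subfields of a field type\<close>

text \<open>\<open>henselian\<close> only supplies a root near a simple residual root, so the
  invariance of \<open>hval\<close> under the Galois group has to be extracted from it. The lever is
  isolation: an element congruent to 1 all of whose other conjugates lie in the maximal ideal is
  itself in \<open>K\<close>, hence has no other conjugates. Two conjugates of different value would
  allow an element to be built that contradicts this.

  The obstacle in computing the fixed field is to lift the shift of \<alpha> by 1. It changes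
  \<alpha>^2 by \<open>2 * \<alpha> + 1\<close>, so the lift must move \<eta> by some
  \<open>d\<close> with \<open>d ^ p - d = 2 * \<alpha> + 1\<close>. The choice
  \<open>d = 2 * \<theta> + hconst c\<close> with \<open>c ^ p - c = 1\<close> works, because
  \<theta> already solves \<open>\<theta> ^ p - \<theta> = \<alpha>\<close> and the field of
  constants is algebraically closed.

  As the constants lie in \<open>K\<close>, automorphisms also act trivially on residues. The
  quotients of successive conjugates of \<open>b\<close> therefore share one residue, and their
  telescoping product is a power of it.\<close>

abbreviation type_subfield :: "'a::field set \<Rightarrow> bool"
  where "type_subfield F \<equiv> subfield F (ring_of_type_algebra :: 'a ring)"

lemma ring_of_type_algebra_simps [simp]:
  "carrier (ring_of_type_algebra :: 'a::field ring) = UNIV"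
  "\<one>\<^bsub>ring_of_type_algebra\<^esub> = (1::'a)"
  "\<zero>\<^bsub>ring_of_type_algebra\<^esub> = (0::'a)"
  "x \<otimes>\<^bsub>ring_of_type_algebra\<^esub> y = (x * y::'a)"
  "x \<oplus>\<^bsub>ring_of_type_algebra\<^esub> y = (x + y::'a)"
  by (simp_all add: ring_of_type_algebra_def)

lemma ring_of_type_algebra_a_inv [simp]:
  "\<ominus>\<^bsub>ring_of_type_algebra\<^esub> x = (- x :: 'a::field)"
proof -
  interpret R: field "ring_of_type_algebra :: 'a ring" by (rule field_from_type_algebra)
  show ?thesis by (rule R.minus_equality) auto
qed

lemma ring_of_type_algebra_m_inv:
  "x \<noteq> 0 \<Longrightarrow> inv\<^bsub>ring_of_type_algebra\<^esub> x = (inverse x :: 'a::field)"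
proof -
  interpret R: field "ring_of_type_algebra :: 'a ring" by (rule field_from_type_algebra)
  show "x \<noteq> 0 \<Longrightarrow> ?thesis" by (rule R.comm_inv_char) auto
qed

lemma type_subfieldI:
  fixes F :: "'a::field set"
  assumes "1 \<in> F" "\<And>x. x \<in> F \<Longrightarrow> - x \<in> F" "\<And>x y. x \<in> F \<Longrightarrow> y \<in> F \<Longrightarrow> x + y \<in> F"
    "\<And>x y. x \<in> F \<Longrightarrow> y \<in> F \<Longrightarrow> x * y \<in> F" "\<And>x. x \<in> F \<Longrightarrow> x \<noteq> 0 \<Longrightarrow> inverse x \<in> F"
  shows "type_subfield F"
proof -
  interpret R: field "ring_of_type_algebra :: 'a ring" by (rule field_from_type_algebra)
  show ?thesis
    by (intro R.subfieldI' R.subringI) (auto simp: assms ring_of_type_algebra_m_inv)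
qed

lemma type_subfield_closed:
  fixes F :: "'a::field set"
  assumes F: "type_subfield F"
  shows "0 \<in> F" "1 \<in> F"
    "\<And>x. x \<in> F \<Longrightarrow> - x \<in> F"
    "\<And>x. x \<in> F \<Longrightarrow> inverse x \<in> F"
    "\<And>x y. x \<in> F \<Longrightarrow> y \<in> F \<Longrightarrow> x + y \<in> F"
    "\<And>x y. x \<in> F \<Longrightarrow> y \<in> F \<Longrightarrow> x - y \<in> F"
    "\<And>x y. x \<in> F \<Longrightarrow> y \<in> F \<Longrightarrow> x * y \<in> F"
    "\<And>x y. x \<in> F \<Longrightarrow> y \<in> F \<Longrightarrow> x / y \<in> F"
    "\<And>x n. x \<in> F \<Longrightarrow> x ^ n \<in> F"
    "\<And>n. of_nat n \<in> F"
proof -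
  interpret R: field "ring_of_type_algebra :: 'a ring" by (rule field_from_type_algebra)
  note sub = subringE[OF subfieldE(1)[OF F]]
  show z: "0 \<in> F" and o: "1 \<in> F" using sub(2,3) by simp_all
  show m: "\<And>x. x \<in> F \<Longrightarrow> - x \<in> F" using sub(5) by simp
  show i: "inverse x \<in> F" if "x \<in> F" for x
    using R.subfield_m_inv(1)[OF F, of x] that z
    by (cases "x = 0") (auto simp: ring_of_type_algebra_m_inv)
  show a: "\<And>x y. x \<in> F \<Longrightarrow> y \<in> F \<Longrightarrow> x + y \<in> F" using sub(7) by simp
  show "x - y \<in> F" if "x \<in> F" "y \<in> F" for x y
    using a[OF that(1) m[OF that(2)]] by simp
  show t: "\<And>x y. x \<in> F \<Longrightarrow> y \<in> F \<Longrightarrow> x * y \<in> F" using sub(6) by simp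
  show "x / y \<in> F" if "x \<in> F" "y \<in> F" for x y
    using t[OF that(1) i[OF that(2)]] by (simp add: field_simps)
  show "x ^ n \<in> F" if "x \<in> F" for x n
    using that by (induction n) (auto intro: o t)
  show "of_nat n \<in> F" for n
    by (induction n) (auto intro: z o a)
qed

lemma type_subfield_sum:
  assumes "type_subfield F" "\<And>i. i \<in> A \<Longrightarrow> f i \<in> F"
  shows "sum f A \<in> F"
  using assms(2) by (induction A rule: infinite_finite_induct) (auto intro: type_subfield_closed[OF assms(1)])

lemma type_subfield_prod:
  assumes "type_subfield F" "\<And>i. i \<in> A \<Longrightarrow> f i \<in> F"
  shows "prod f A \<in> F"
  using assms(2) by (induction A rule: infinite_finite_induct) (auto intro: type_subfield_closed[OF assms(1)])

lemma generate_field_type: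
  fixes A :: "'a::field set"
  shows "type_subfield (generate_field ring_of_type_algebra A)" "A \<subseteq> generate_field ring_of_type_algebra A"
    "\<And>E. type_subfield E \<Longrightarrow> A \<subseteq> E \<Longrightarrow> generate_field ring_of_type_algebra A \<subseteq> E"
proof -
  interpret R: field "ring_of_type_algebra :: 'a ring" by (rule field_from_type_algebra)
  show "type_subfield (generate_field ring_of_type_algebra A)"
    "A \<subseteq> generate_field ring_of_type_algebra A"
    "\<And>E. type_subfield E \<Longrightarrow> A \<subseteq> E \<Longrightarrow> generate_field ring_of_type_algebra A \<subseteq> E"
    using R.generate_fieldE[of A] by auto
qed

subsection \<open>Polynomials over a subfield\<close>

definition polys_over :: "'a::zero set \<Rightarrow> 'a poly set"
  where "polys_over F = {f. \<forall>i. coeff f i \<in> F}"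

lemma polys_overD: "f \<in> polys_over F \<Longrightarrow> coeff f i \<in> F"
  by (simp add: polys_over_def)

lemma polys_over_closed:
  fixes F :: "'a::field set"
  assumes F: "type_subfield F"
  shows "0 \<in> polys_over F"
    "\<And>f g. f \<in> polys_over F \<Longrightarrow> g \<in> polys_over F \<Longrightarrow> f + g \<in> polys_over F"
    "\<And>f g. f \<in> polys_over F \<Longrightarrow> g \<in> polys_over F \<Longrightarrow> f - g \<in> polys_over F"
    "\<And>f. f \<in> polys_over F \<Longrightarrow> - f \<in> polys_over F"
    "\<And>f g. f \<in> polys_over F \<Longrightarrow> g \<in> polys_over F \<Longrightarrow> f * g \<in> polys_over F"
    "\<And>c f. c \<in> F \<Longrightarrow> f \<in> polys_over F \<Longrightarrow> smult c f \<in> polys_over F"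
    "\<And>c n. c \<in> F \<Longrightarrow> monom c n \<in> polys_over F"
    "\<And>c f. c \<in> F \<Longrightarrow> f \<in> polys_over F \<Longrightarrow> pCons c f \<in> polys_over F"
  using type_subfield_closed[OF F]
  by (auto simp: polys_over_def coeff_mult coeff_pCons split: nat.splits intro!: type_subfield_sum[OF F])

lemma poly_over_mem:
  fixes F :: "'a::field set"
  assumes "type_subfield L" "F \<subseteq> L" "f \<in> polys_over F" "x \<in> L"
  shows "poly f x \<in> L"
  unfolding poly_altdef
  by (intro type_subfield_sum[OF assms(1)] type_subfield_closed(7,9)[OF assms(1)])
     (use assms polys_overD[OF assms(3)] in auto)

text \<open>Long division is carried out explicitly because quotient and remainder have to keep
  their coefficients in \<open>F\<close>; each step only divides one leading coefficient by
  another.\<close>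

lemma polys_over_divide:
  fixes F :: "'a::field set"
  assumes F: "type_subfield F" and g: "g \<in> polys_over F" "g \<noteq> 0" and f: "f \<in> polys_over F"
  shows "\<exists>q\<in>polys_over F. \<exists>r\<in>polys_over F. f = q * g + r \<and> (r = 0 \<or> degree r < degree g)"
  using f
proof (induction "degree f" arbitrary: f rule: less_induct)
  case less
  show ?case
  proof (cases "f = 0 \<or> degree f < degree g")
    case True
    then show ?thesis using less.prems polys_over_closed(1)[OF F]
      by (intro bexI[of _ 0] bexI[of _ f]) auto
  next
    case False
    define h where "h = monom (lead_coeff f / lead_coeff g) (degree f - degree g)"
    have h: "h \<in> polys_over F"
      unfolding h_def using less.prems g
      by (intro polys_over_closed[OF F] type_subfield_closed[OF F] polys_overD)
    have c: "lead_coeff f / lead_coeff g \<noteq> 0" using False g by simp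
    have deg: "degree (h * g) = degree f"
      using False g c by (simp add: h_def degree_mult_eq degree_monom_eq)
    have lc: "lead_coeff (h * g) = lead_coeff f"
      using g c by (simp add: h_def lead_coeff_mult degree_monom_eq)
    define f' where "f' = f - h * g"
    have f': "f' \<in> polys_over F"
      unfolding f'_def using less.prems h g by (intro polys_over_closed[OF F])
    \<comment> \<open>A constant cannot drop in degree, so in degree 0 the cancellation has to be
      recorded as \<open>f' = 0\<close>.\<close>
    have "f' = 0 \<or> degree f' < degree f"
    proof (cases "degree f = 0")
      case True
      then have "f' = 0" using deg lc by (auto simp: f'_def elim!: degree_eq_zeroE)
      then show ?thesis ..
    next
      case False
      have "degree f' \<noteq> degree f \<or> f' = 0"
        using deg lc by (metis coeff_diff f'_def leading_coeff_0_iff right_minus_eq)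
      then show ?thesis
        using degree_diff_le[of f "degree f" "h * g"] deg by (auto simp: f'_def)
    qed
    then obtain q r where qr: "q \<in> polys_over F" "r \<in> polys_over F" "f' = q * g + r"
      "r = 0 \<or> degree r < degree g"
    proof
      assume "f' = 0"
      then show thesis using that[of 0 0] polys_over_closed(1)[OF F] by auto
    next
      assume "degree f' < degree f"
      then show thesis using that less.hyps[OF _ f'] by blast
    qed
    have "f = (q + h) * g + r" using qr(3) by (simp add: f'_def algebra_simps)
    then show ?thesis using qr h polys_over_closed(2)[OF F] by blast
  qed
qed

subsection \<open>Automorphisms of subfields\<close>

text \<open>Values outside \<open>F\<close> are left free, so that iterates and composites qualify
  as they stand, unlike the extensional members of \<open>gal\<close>. Preservation of 1 follows
  from multiplicativity and injectivity.\<close>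

definition field_aut :: "'a::field set \<Rightarrow> ('a \<Rightarrow> 'a) \<Rightarrow> bool"
  where "field_aut F \<tau> \<longleftrightarrow> bij_betw \<tau> F F \<and>
    (\<forall>x\<in>F. \<forall>y\<in>F. \<tau> (x + y) = \<tau> x + \<tau> y \<and> \<tau> (x * y) = \<tau> x * \<tau> y)"

lemma field_aut_id: "field_aut F (\<lambda>x. x)"
  by (auto simp: field_aut_def bij_betw_def)

lemma field_aut_hom:
  fixes F :: "'a::field set"
  assumes F: "type_subfield F" and \<tau>: "field_aut F \<tau>"
  shows "\<And>x. x \<in> F \<Longrightarrow> \<tau> x \<in> F"
    "\<tau> 0 = 0" "\<tau> 1 = 1"
    "\<And>x y. x \<in> F \<Longrightarrow> y \<in> F \<Longrightarrow> \<tau> (x + y) = \<tau> x + \<tau> y"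
    "\<And>x y. x \<in> F \<Longrightarrow> y \<in> F \<Longrightarrow> \<tau> (x * y) = \<tau> x * \<tau> y"
    "\<And>x. x \<in> F \<Longrightarrow> \<tau> (- x) = - \<tau> x"
    "\<And>x y. x \<in> F \<Longrightarrow> y \<in> F \<Longrightarrow> \<tau> (x - y) = \<tau> x - \<tau> y"
    "\<And>x. x \<in> F \<Longrightarrow> \<tau> x = 0 \<longleftrightarrow> x = 0"
    "\<And>x. x \<in> F \<Longrightarrow> \<tau> (inverse x) = inverse (\<tau> x)"
    "\<And>x y. x \<in> F \<Longrightarrow> y \<in> F \<Longrightarrow> \<tau> (x / y) = \<tau> x / \<tau> y"
    "\<And>x n. x \<in> F \<Longrightarrow> \<tau> (x ^ n) = \<tau> x ^ n"
proof -
  note cl = type_subfield_closed[OF F]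
  show mem: "\<And>x. x \<in> F \<Longrightarrow> \<tau> x \<in> F" using \<tau> by (auto simp: field_aut_def bij_betw_def)
  show add: "\<And>x y. x \<in> F \<Longrightarrow> y \<in> F \<Longrightarrow> \<tau> (x + y) = \<tau> x + \<tau> y"
    and mult: "\<And>x y. x \<in> F \<Longrightarrow> y \<in> F \<Longrightarrow> \<tau> (x * y) = \<tau> x * \<tau> y"
    using \<tau> by (auto simp: field_aut_def)
  have inj: "inj_on \<tau> F" using \<tau> by (auto simp: field_aut_def bij_betw_def)
  show z: "\<tau> 0 = 0" using add[OF cl(1) cl(1)] by (metis add_0_left add_cancel_left_left)
  show nz: "\<tau> x = 0 \<longleftrightarrow> x = 0" if "x \<in> F" for x
    using inj_onD[OF inj, of x 0] z that cl by auto
  show one: "\<tau> 1 = 1" using mult[of 1 1] nz[of 1] cl by auto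
  show neg: "\<tau> (- x) = - \<tau> x" if "x \<in> F" for x
    using add[of x "- x"] that cl z by (simp add: eq_neg_iff_add_eq_0 add.commute)
  show "\<tau> (x - y) = \<tau> x - \<tau> y" if "x \<in> F" "y \<in> F" for x y
    using add[of x "- y"] neg[of y] that cl by simp
  show inv: "\<tau> (inverse x) = inverse (\<tau> x)" if "x \<in> F" for x
  proof (cases "x = 0")
    case False
    then have "\<tau> x * \<tau> (inverse x) = 1"
      using mult[of x "inverse x"] that cl one by simp
    then show ?thesis by (simp add: inverse_unique)
  qed (simp add: z)
  show "\<tau> (x / y) = \<tau> x / \<tau> y" if "x \<in> F" "y \<in> F" for x y
    using mult[of x "inverse y"] inv[of y] that cl by (simp add: field_simps)
  show "\<tau> (x ^ n) = \<tau> x ^ n" if "x \<in> F" for x n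
    using that by (induction n) (auto simp: one mult cl)
qed

lemma field_aut_sum:
  assumes F: "type_subfield F" and \<tau>: "field_aut F \<tau>" and "\<And>i. i \<in> A \<Longrightarrow> f i \<in> F"
  shows "\<tau> (sum f A) = (\<Sum>i\<in>A. \<tau> (f i))"
  using assms(3)
  by (induction A rule: infinite_finite_induct)
     (auto simp: field_aut_hom(2,4)[OF F \<tau>] type_subfield_sum[OF F])

lemma field_aut_prod:
  assumes F: "type_subfield F" and \<tau>: "field_aut F \<tau>" and "\<And>i. i \<in> A \<Longrightarrow> f i \<in> F"
  shows "\<tau> (prod f A) = (\<Prod>i\<in>A. \<tau> (f i))"
  using assms(3)
  by (induction A rule: infinite_finite_induct)
     (auto simp: field_aut_hom(3,5)[OF F \<tau>] type_subfield_prod[OF F])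

lemma map_poly_field_aut:
  fixes F :: "'a::field set"
  assumes F: "type_subfield F" and \<tau>: "field_aut F \<tau>"
  shows "\<And>f. f \<in> polys_over F \<Longrightarrow> map_poly \<tau> f \<in> polys_over F"
    "\<And>f g. f \<in> polys_over F \<Longrightarrow> g \<in> polys_over F \<Longrightarrow> map_poly \<tau> (f + g) = map_poly \<tau> f + map_poly \<tau> g"
    "\<And>f g. f \<in> polys_over F \<Longrightarrow> g \<in> polys_over F \<Longrightarrow> map_poly \<tau> (f * g) = map_poly \<tau> f * map_poly \<tau> g"
proof -
  note hom = field_aut_hom[OF F \<tau>]
  show "map_poly \<tau> f \<in> polys_over F" if "f \<in> polys_over F" for f
    using that by (auto simp: polys_over_def coeff_map_poly hom)
  show "map_poly \<tau> (f + g) = map_poly \<tau> f + map_poly \<tau> g" if "f \<in> polys_over F" "g \<in> polys_over F" for f g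
    using that by (intro poly_eqI) (auto simp: polys_over_def coeff_map_poly hom)
  show "map_poly \<tau> (f * g) = map_poly \<tau> f * map_poly \<tau> g" if "f \<in> polys_over F" "g \<in> polys_over F" for f g
    using that
    by (intro poly_eqI)
       (auto simp: polys_over_def coeff_map_poly coeff_mult hom field_aut_sum[OF F \<tau>]
          type_subfield_closed[OF F])
qed

subsection \<open>Artin--Schreier extensions\<close>

text \<open>Induction over \<open>A\<close>: the new point \<open>a\<close> is a root of
  \<open>m\<close> and is cancelled there, or it is a root of the cofactor and is cancelled from
  that.\<close>

lemma dvd_prod_linear_factors:
  fixes m :: "'a::field poly"
  assumes "finite A" "m dvd (\<Prod>z\<in>A. [:- z, 1:])" "lead_coeff m = 1"
  shows "\<exists>S\<subseteq>A. m = (\<Prod>z\<in>S. [:- z, 1:])"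
  using assms
proof (induction A arbitrary: m rule: finite_induct)
  case empty
  then have "m dvd 1" by simp
  then obtain c where "m = [:c:]" using is_unit_polyE by blast
  then show ?case using empty.prems(2) by (intro exI[of _ "{}"]) (auto simp: one_pCons)
next
  case (insert a A)
  let ?R = "\<Prod>z\<in>A. [:- z, 1:]"
  have "(\<Prod>z\<in>insert a A. [:- z, 1:]) = [:- a, 1:] * ?R"
    using insert.hyps by (rule prod.insert)
  then obtain k where k: "[:- a, 1:] * ?R = m * k" using insert.prems(1) by (metis dvdE)
  have nz: "[:- a, 1:] \<noteq> 0" by simp
  show ?case
  proof (cases "poly m a = 0")
    case True
    then obtain m' where m': "m = [:- a, 1:] * m'" by (auto simp: poly_eq_0_iff_dvd)
    then have "[:- a, 1:] * ?R = [:- a, 1:] * (m' * k)" using k by (simp only: mult.assoc)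
    then have "?R = m' * k" using nz mult_left_cancel by blast
    moreover have "lead_coeff m' = 1" using insert.prems(2) m' by (simp only: lead_coeff_mult) simp
    ultimately obtain S where "S \<subseteq> A" "m' = (\<Prod>z\<in>S. [:- z, 1:])" using insert.IH[of m'] by auto
    then show ?thesis using insert.hyps m' finite_subset[of S A]
      by (intro exI[of _ "insert a S"]) (auto simp: prod.insert_if)
  next
    case False
    have "poly (m * k) a = 0" unfolding k[symmetric] by simp
    then have "poly k a = 0" using False by simp
    then obtain k' where k': "k = [:- a, 1:] * k'" by (auto simp: poly_eq_0_iff_dvd)
    then have "[:- a, 1:] * ?R = [:- a, 1:] * (m * k')" using k by (simp only: ac_simps)
    then have "?R = m * k'" using nz mult_left_cancel by blast
    then obtain S where "S \<subseteq> A" "m = (\<Prod>z\<in>S. [:- z, 1:])"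
      using insert.IH[of m] insert.prems(2) by (metis dvd_triv_left)
    then show ?thesis by blast
  qed
qed

text \<open>Vieta's formula for the sum of the roots is what later expresses a multiple of
  \<open>x\<close> by elements of the base field.\<close>

lemma prod_linear_factors_coeffs:
  fixes S :: "'a::field set"
  assumes "finite S"
  shows "degree (\<Prod>z\<in>S. [:- z, 1:]) = card S" "lead_coeff (\<Prod>z\<in>S. [:- z, 1:]) = 1"
    "S \<noteq> {} \<Longrightarrow> coeff (\<Prod>z\<in>S. [:- z, 1:]) (card S - 1) = - (\<Sum>z\<in>S. z)"
proof -
  show deg: "degree (\<Prod>z\<in>S. [:- z, 1:]) = card S" for S :: "'a set"
    by (subst degree_prod_eq_sum_degree) auto
  show lc: "lead_coeff (\<Prod>z\<in>S. [:- z, 1:]) = 1" for S :: "'a set"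
    by (simp add: lead_coeff_prod)
  show "S \<noteq> {} \<Longrightarrow> coeff (\<Prod>z\<in>S. [:- z, 1:]) (card S - 1) = - (\<Sum>z\<in>S. z)"
    using assms
  proof (induction S rule: finite_induct)
    case (insert a S)
    have "coeff (\<Prod>z\<in>S. [:- z, 1:]) (card S) = 1" using lc[of S] deg[of S] by simp
    then show ?case using insert
      by (cases "S = {}") (auto simp: coeff_pCons card_gt_0_iff split: nat.splits)
  qed auto
qed

text \<open>No denominators are needed for Artin-Schreier roots, and every element comes with a
  polynomial to whose coefficients an automorphism can be applied.\<close>

definition adjoin :: "'a::comm_semiring_0 set \<Rightarrow> 'a \<Rightarrow> 'a set"
  where "adjoin F x = {poly f x |f. f \<in> polys_over F}"

context
  fixes p :: nat
  assumes p: "p = CHAR('a::field)" "Factorial_Ring.prime p"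
begin

section \<open>The Frobenius map and the Artin-Schreier polynomial\<close>

lemma frobenius_add: "(x + y :: 'a) ^ p = x ^ p + y ^ p"
  using p by (simp add: freshmans_dream)

lemma frobenius_diff: "(x - y :: 'a) ^ p = x ^ p - y ^ p"
  using frobenius_add[of "x - y" y] by simp

lemma frobenius_minus: "(- x :: 'a) ^ p = - (x ^ p)"
  using frobenius_diff[of 0 x] p prime_gt_0_nat by (simp add: power_0_left)

lemma frobenius_of_nat: "(of_nat n :: 'a) ^ p = of_nat n"
proof (induction n)
  case (Suc n)
  then show ?case using frobenius_add[of 1 "of_nat n"] by simp
qed (use p prime_gt_0_nat in auto)

text \<open>The left side is X^p - X - (x^p - x). The Frobenius is additive and fixes the integers,
  so all \<open>p\<close> translates \<open>x + of_nat i\<close> are roots. Both sides are monic of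
  degree \<open>p\<close>, and their difference has too many roots for its degree.\<close>

lemma artin_schreier_poly_eq_prod:
  fixes x :: 'a
  shows "monom 1 p - [:x ^ p - x, 1:] = (\<Prod>z\<in>(\<lambda>i. x + of_nat i) ` {..<p}. [:- z, 1:])"
    and "card ((\<lambda>i. x + of_nat i) ` {..<p}) = p"
proof -
  let ?A = "(\<lambda>i. x + of_nat i) ` {..<p}"
  let ?P = "monom 1 p - [:x ^ p - x, 1:]" and ?Q = "\<Prod>z\<in>?A. [:- z, 1:]"
  have p1: "p > 1" using p prime_gt_1_nat by blast
  have inj: "inj_on (\<lambda>i. x + of_nat i) {..<p}"
  proof (rule inj_onI)
    fix i j assume "i \<in> {..<p}" "j \<in> {..<p}" "x + of_nat i = x + of_nat j"
    then have "[i = j] (mod p)" using of_nat_eq_iff_cong_CHAR[where 'a = 'a] p by simp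
    then show "i = j" using \<open>i \<in> {..<p}\<close> \<open>j \<in> {..<p}\<close> by (simp add: cong_def)
  qed
  then show card: "card ?A = p" by (simp add: card_image)
  have "degree ([:x ^ p - x, 1:]) < p" using p1 by simp
  then have cP: "coeff ?P p = 1" "degree ?P \<le> p"
    using p1 by (auto simp: coeff_eq_0 degree_diff_le degree_monom_le)
  have cQ: "coeff ?Q p = 1" "degree ?Q = p"
    using prod_linear_factors_coeffs(1,2)[of ?A] card by auto
  have root: "poly (?P - ?Q) z = 0" if "z \<in> ?A" for z
  proof -
    have "poly ?Q z = 0" using that by (auto simp: poly_prod)
    moreover have "poly ?P z = 0"
      using that by (auto simp: poly_monom frobenius_add frobenius_of_nat)
    ultimately show ?thesis by simp
  qed
  have "?P - ?Q = 0"
  proof (rule ccontr)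
    assume nz: "?P - ?Q \<noteq> 0"
    have "degree (?P - ?Q) \<le> p" using cP cQ by (simp add: degree_diff_le)
    moreover have "degree (?P - ?Q) \<noteq> p"
      using nz cP cQ by (metis coeff_diff diff_self leading_coeff_0_iff)
    moreover have "p \<le> card {z. poly (?P - ?Q) z = 0}"
      using card card_mono[OF poly_roots_finite[OF nz], of ?A] root by fastforce
    ultimately show False using card_poly_roots_bound[OF nz] by linarith
  qed
  then show "?P = ?Q" by simp
qed

context
  fixes F :: "'a set" and x :: 'a
  assumes F: "type_subfield F" and x: "x ^ p - x \<in> F"
begin

lemma artin_schreier_poly:
  "monom 1 p - [:x ^ p - x, 1:] \<in> polys_over F" "degree (monom 1 p - [:x ^ p - x, 1:]) = p"
  "monom 1 p - [:x ^ p - x, 1:] \<noteq> 0" "poly (monom 1 p - [:x ^ p - x, 1:]) x = 0"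
proof -
  note cl = type_subfield_closed[OF F]
  show "monom 1 p - [:x ^ p - x, 1:] \<in> polys_over F"
    by (intro polys_over_closed[OF F] cl x)
  show *: "degree (monom 1 p - [:x ^ p - x, 1:]) = p"
    using artin_schreier_poly_eq_prod[of x] prod_linear_factors_coeffs(1)[of "(\<lambda>i. x + of_nat i) ` {..<p}"]
    by simp
  show "monom 1 p - [:x ^ p - x, 1:] \<noteq> 0" using * p prime_gt_0_nat by fastforce
  show "poly (monom 1 p - [:x ^ p - x, 1:]) x = 0" by (simp add: poly_monom)
qed

text \<open>The minimal polynomial of \<open>x\<close> is a product of \<open>d\<close> factors \<open>X - (x + i)\<close>, and \<open>d x\<close> can be
  read off from its second coefficient.\<close>
lemma artin_schreier_minimal:
  assumes nin: "x \<notin> F" and f: "f \<in> polys_over F" "degree f < p" "poly f x = 0"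
  shows "f = 0"
proof (rule ccontr)
  assume "f \<noteq> 0"
  note cl = type_subfield_closed[OF F]
  let ?I = "\<lambda>g. g \<in> polys_over F \<and> g \<noteq> 0 \<and> poly g x = 0"
  let ?P = "monom 1 p - [:x ^ p - x, 1:]"
  define m0 where "m0 = arg_min degree ?I"
  have "?I f" using f \<open>f \<noteq> 0\<close> by simp
  then have m0: "?I m0" and min0: "\<And>g. ?I g \<Longrightarrow> degree m0 \<le> degree g"
    unfolding m0_def using arg_min_nat_lemma[of ?I f degree] by blast+
  define m where "m = smult (inverse (lead_coeff m0)) m0"
  have m: "?I m" "lead_coeff m = 1" and dm: "degree m = degree m0"
    unfolding m_def using m0 by (auto intro!: polys_over_closed[OF F] cl polys_overD)
  obtain q r where qr: "q \<in> polys_over F" "r \<in> polys_over F" "?P = q * m + r"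
    "r = 0 \<or> degree r < degree m"
    using polys_over_divide[OF F _ _ artin_schreier_poly(1), of m] m(1) by blast
  have "poly ?P x = poly (q * m + r) x" using qr(3) by simp
  then have "poly r x = 0" using artin_schreier_poly(4) m(1) by simp
  then have "r = 0" using qr min0[of r] dm by force
  then have "m dvd (\<Prod>z\<in>(\<lambda>i. x + of_nat i) ` {..<p}. [:- z, 1:])"
    using qr(3) artin_schreier_poly_eq_prod(1)[of x] by simp
  then obtain S where S: "S \<subseteq> (\<lambda>i. x + of_nat i) ` {..<p}" "m = (\<Prod>z\<in>S. [:- z, 1:])"
    using dvd_prod_linear_factors[of _ m] m(2) by blast
  have fin: "finite S" using S finite_subset by blast
  have card: "card S < p" using S(2) prod_linear_factors_coeffs(1)[OF fin] dm min0[OF \<open>?I f\<close>] f(2) by simp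
  have ne: "S \<noteq> {}" using S(2) m(1) by auto
  \<comment> \<open>The roots in \<open>S\<close> differ from \<open>x\<close> by integers, so their
    sum is \<open>card S\<close> times \<open>x\<close> up to an element of \<open>F\<close>. From
    \<open>0 < card S < p\<close> it follows that the factor is invertible.\<close>
  have "x * of_nat (card S) + (\<Sum>z\<in>S. z - x) = (\<Sum>z\<in>S. z)"
    by (simp add: sum_subtractf mult.commute)
  moreover have "(\<Sum>z\<in>S. z - x) \<in> F"
  proof (rule type_subfield_sum[OF F])
    show "z - x \<in> F" if "z \<in> S" for z using S(1) that cl(10) by auto
  qed
  moreover have "(\<Sum>z\<in>S. z) \<in> F"
    using prod_linear_factors_coeffs(3)[OF fin ne] polys_overD[of m F "card S - 1"] m(1) S(2)
      cl(3)[of "coeff m (card S - 1)"] by simp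
  ultimately have "x * of_nat (card S) \<in> F" using cl(6) by (metis add_diff_cancel_right')
  moreover have "(of_nat (card S) :: 'a) \<noteq> 0"
    using card ne fin p(1) by (auto simp: of_nat_eq_0_iff_char_dvd dest: dvd_imp_le)
  ultimately have "x \<in> F" using cl(8)[of "x * of_nat (card S)" "of_nat (card S)"] cl(10) by simp
  then show False using nin by simp
qed

section \<open>The field generated by an Artin-Schreier root and its automorphisms\<close>

lemma adjoin_incl: "F \<subseteq> adjoin F x" "x \<in> adjoin F x"
proof -
  show "F \<subseteq> adjoin F x"
  proof
    fix c assume "c \<in> F"
    then show "c \<in> adjoin F x" unfolding adjoin_def
      by (intro CollectI exI[of _ "[:c:]"] conjI polys_over_closed[OF F]) auto
  qed
  show "x \<in> adjoin F x" unfolding adjoin_def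
    by (intro CollectI exI[of _ "[:0, 1:]"] conjI polys_over_closed[OF F] type_subfield_closed[OF F]) auto
qed

lemma adjoin_min:
  assumes "type_subfield L" "F \<subseteq> L" "x \<in> L"
  shows "adjoin F x \<subseteq> L"
  using poly_over_mem[OF assms(1,2) _ assms(3)] by (auto simp: adjoin_def)

lemma adjoin_eq_self: "x \<in> F \<Longrightarrow> adjoin F x = F"
  using adjoin_min[OF F] adjoin_incl by blast

lemma adjoin_reduced:
  assumes "y \<in> adjoin F x"
  obtains f where "f \<in> polys_over F" "degree f < p" "y = poly f x"
proof -
  note P = artin_schreier_poly
  obtain g where g: "g \<in> polys_over F" "y = poly g x" using assms by (auto simp: adjoin_def)
  obtain q r where qr: "r \<in> polys_over F" "g = q * (monom 1 p - [:x ^ p - x, 1:]) + r"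
    "r = 0 \<or> degree r < p"
    using polys_over_divide[OF F P(1,3) g(1)] P(2) by auto
  have "degree r < p" using qr(3) p prime_gt_0_nat by auto
  moreover have "y = poly r x" using g(2) P(4) unfolding qr(2) by simp
  ultimately show thesis using that qr(1) by blast
qed

text \<open>Inverses are found by Euclidean descent: dividing the Artin-Schreier polynomial by
  \<open>g\<close> gives q(x) g(x) = -r(x), which passes from \<open>g\<close> to the remainder
  \<open>r\<close> of smaller degree.\<close>

lemma adjoin_subfield: "type_subfield (adjoin F x)"
proof (cases "x \<in> F")
  case True
  then show ?thesis using F adjoin_eq_self by simp
next
  case False
  note P = artin_schreier_poly and min = artin_schreier_minimal[OF False]
  have inv: "\<exists>h\<in>polys_over F. poly g x * poly h x = 1"
    if "g \<in> polys_over F" "degree g < p" "poly g x \<noteq> 0" for g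
    using that
  proof (induction "degree g" arbitrary: g rule: less_induct)
    case less
    show ?case
    proof (cases "degree g = 0")
      case True
      then obtain c where c: "g = [:c:]" by (auto elim: degree_eq_zeroE)
      then have "c \<in> F" "c \<noteq> 0" using polys_overD[OF less.prems(1), of 0] less.prems(3) by auto
      then show ?thesis using c
        by (intro bexI[of _ "[:inverse c:]"] polys_over_closed[OF F] type_subfield_closed[OF F]) auto
    next
      case False
      have "g \<noteq> 0" using less.prems(3) by auto
      then obtain q r where qr: "q \<in> polys_over F" "r \<in> polys_over F"
        "monom 1 p - [:x ^ p - x, 1:] = q * g + r" "r = 0 \<or> degree r < degree g"
        using polys_over_divide[OF F less.prems(1) _ P(1)] by blast
      have eq: "poly q x * poly g x = - poly r x"
        using P(4) unfolding qr(3) by (simp add: eq_neg_iff_add_eq_0)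
      \<comment> \<open>Otherwise \<open>r = 0\<close>, and the cofactor \<open>q\<close>, of degree
        below \<open>p\<close>, would vanish at \<open>x\<close> against minimality.\<close>
      have "poly r x \<noteq> 0"
      proof
        assume r0: "poly r x = 0"
        have "degree r < p" using qr(4) less.prems(2) by auto
        then have "r = 0" using min qr(2) r0 by blast
        then have "q \<noteq> 0" "degree q + degree g = p"
          using qr(3) P(2,3) degree_mult_eq[of q g] \<open>g \<noteq> 0\<close> by auto
        moreover have "poly q x = 0" using eq r0 less.prems(3) by simp
        ultimately show False using min[of q] qr(1) False by simp
      qed
      moreover from this have "degree r < degree g" using qr(4) by auto
      ultimately obtain h where h: "h \<in> polys_over F" "poly r x * poly h x = 1"
        using less.hyps[of r] less.prems(2) qr(2) by auto
      have "poly g x * poly (- (q * h)) x = - (poly q x * poly g x) * poly h x" by (simp add: ac_simps)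
      also have "\<dots> = 1" unfolding eq using h by simp
      finally show ?thesis using h(1) qr(1) polys_over_closed(4,5)[OF F] by blast
    qed
  qed
  show ?thesis
  proof (rule type_subfieldI)
    show "1 \<in> adjoin F x" using adjoin_incl(1) type_subfield_closed(2)[OF F] by blast
    show "- y \<in> adjoin F x" if "y \<in> adjoin F x" for y
      using that polys_over_closed(4)[OF F] unfolding adjoin_def by (smt (verit) mem_Collect_eq poly_minus)
    show "y + z \<in> adjoin F x" if "y \<in> adjoin F x" "z \<in> adjoin F x" for y z
      using that polys_over_closed(2)[OF F] unfolding adjoin_def by (smt (verit) mem_Collect_eq poly_add)
    show "y * z \<in> adjoin F x" if "y \<in> adjoin F x" "z \<in> adjoin F x" for y z
      using that polys_over_closed(5)[OF F] unfolding adjoin_def by (smt (verit) mem_Collect_eq poly_mult)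
    show "inverse y \<in> adjoin F x" if "y \<in> adjoin F x" "y \<noteq> 0" for y
    proof -
      obtain g where g: "g \<in> polys_over F" "degree g < p" "y = poly g x"
        using adjoin_reduced \<open>y \<in> adjoin F x\<close> by blast
      then obtain h where "h \<in> polys_over F" "y * poly h x = 1" using inv[of g] \<open>y \<noteq> 0\<close> by blast
      then show ?thesis using inverse_unique[of y "poly h x"] by (auto simp: adjoin_def)
    qed
  qed
qed

text \<open>The condition on \<open>d\<close> says that \<open>x + d\<close> is a root of the
  Artin-Schreier polynomial with its coefficients moved by \<tau>. If \<open>x\<close> is already in
  \<open>F\<close>, the extension is \<tau> itself, hence the guard in the last conclusion.\<close>

lemma artin_schreier_extend:
  assumes \<tau>: "field_aut F \<tau>" and d: "d \<in> F" "d ^ p - d = \<tau> (x ^ p - x) - (x ^ p - x)"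
  obtains \<sigma> where "field_aut (adjoin F x) \<sigma>" "\<And>y. y \<in> F \<Longrightarrow> \<sigma> y = \<tau> y"
    "x \<notin> F \<Longrightarrow> \<sigma> x = x + d"
proof (cases "x \<in> F")
  case True
  then show ?thesis using that[of \<tau>] \<tau> adjoin_eq_self by simp
next
  case False
  let ?P = "monom 1 p - [:x ^ p - x, 1:]"
  note cl = type_subfield_closed[OF F] and hom = field_aut_hom[OF F \<tau>] and pcl = polys_over_closed[OF F]
  note mp = map_poly_field_aut[OF F \<tau>] and P = artin_schreier_poly
  have cL: "type_subfield (adjoin F x)" by (rule adjoin_subfield)
  have rootP: "poly (map_poly \<tau> ?P) (x + d) = 0"
  proof -
    have "\<tau> (- 1) = - 1" using hom(6)[OF cl(2)] hom(3) by simp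
    then have "map_poly \<tau> ?P = monom 1 p - [:\<tau> (x ^ p - x), 1:]"
      using p prime_gt_1_nat hom(6)[OF x]
      by (intro poly_eqI) (auto simp: coeff_map_poly coeff_pCons hom split: nat.splits)
    then have "poly (map_poly \<tau> ?P) (x + d) = (x + d) ^ p - (\<tau> (x ^ p - x) + (x + d))"
      by (simp only: poly_diff poly_monom) simp
    then show ?thesis using d(2) by (simp add: frobenius_add algebra_simps)
  qed
  \<comment> \<open>Well-definedness: a polynomial over \<open>F\<close> vanishing at
    \<open>x\<close> is a multiple of the Artin-Schreier polynomial, so its image vanishes at
    \<open>x + d\<close>.\<close>
  have zero: "poly (map_poly \<tau> f) (x + d) = 0" if f: "f \<in> polys_over F" "poly f x = 0" for f
  proof -
    obtain q r where qr: "q \<in> polys_over F" "r \<in> polys_over F" "f = q * ?P + r" "r = 0 \<or> degree r < p"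
      using polys_over_divide[OF F P(1,3) f(1)] P(2) by auto
    have "poly r x = 0" using f(2) P(4) unfolding qr(3) by simp
    then have "r = 0" using qr artin_schreier_minimal[OF False] by blast
    then show ?thesis using qr rootP P(1) by (simp add: mp)
  qed
  define rep where "rep y = (SOME f. f \<in> polys_over F \<and> poly f x = y)" for y
  have rep: "rep y \<in> polys_over F" "poly (rep y) x = y" if "y \<in> adjoin F x" for y
    using someI_ex[of "\<lambda>f. f \<in> polys_over F \<and> poly f x = y"] that
    unfolding adjoin_def rep_def by blast+
  define \<sigma> where "\<sigma> y = poly (map_poly \<tau> (rep y)) (x + d)" for y
  have \<sigma>: "\<sigma> (poly f x) = poly (map_poly \<tau> f) (x + d)" if f: "f \<in> polys_over F" for f
  proof -
    let ?g = "rep (poly f x)"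
    have g: "?g \<in> polys_over F" "poly ?g x = poly f x" using rep f by (auto simp: adjoin_def)
    have "map_poly \<tau> ?g = map_poly \<tau> (?g - f) + map_poly \<tau> f"
      using mp(2)[of "?g - f" f] g f pcl(3) by simp
    then show ?thesis using zero[of "?g - f"] g f pcl(3) by (simp add: \<sigma>_def)
  qed
  have ext: "\<sigma> y = \<tau> y" if "y \<in> F" for y
  proof -
    have "map_poly \<tau> [:y:] = [:\<tau> y:]"
      by (rule poly_eqI) (auto simp: coeff_map_poly coeff_pCons hom(2) split: nat.splits)
    then show ?thesis using \<sigma>[of "[:y:]"] that pcl(1,8) by simp
  qed
  have sx: "\<sigma> x = x + d"
  proof -
    have "map_poly \<tau> [:0, 1:] = [:0, 1:]"
      by (rule poly_eqI) (auto simp: coeff_map_poly coeff_pCons hom(2,3) split: nat.splits)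
    then show ?thesis using \<sigma>[of "[:0, 1:]"] pcl(1,8) cl(1,2) by simp
  qed
  have add: "\<sigma> (y + z) = \<sigma> y + \<sigma> z" and mult: "\<sigma> (y * z) = \<sigma> y * \<sigma> z"
    if "y \<in> adjoin F x" "z \<in> adjoin F x" for y z
    using \<sigma>[of "rep y + rep z"] \<sigma>[of "rep y * rep z"] that rep[of y] rep[of z] pcl(2,5)
    by (simp_all add: mp \<sigma>_def[of y] \<sigma>_def[of z])
  have dL: "x + d \<in> adjoin F x" using adjoin_incl d(1) type_subfield_closed(5)[OF cL] by blast
  have into: "\<sigma> y \<in> adjoin F x" if "y \<in> adjoin F x" for y
    unfolding \<sigma>_def using rep[OF that] mp(1) dL
    by (intro poly_over_mem[OF cL adjoin_incl(1)]) auto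
  have inj: "inj_on \<sigma> (adjoin F x)"
  proof (rule inj_onI)
    fix y z assume yz: "y \<in> adjoin F x" "z \<in> adjoin F x" "\<sigma> y = \<sigma> z"
    note cl' = type_subfield_closed[OF cL]
    let ?w = "y - z"
    have w: "?w \<in> adjoin F x" using yz cl' by blast
    have "\<sigma> ?w = 0" using add[OF w yz(2)] yz(3) by simp
    then have "\<sigma> (?w * inverse ?w) = 0" using mult[OF w cl'(4)[OF w]] by simp
    moreover have "\<sigma> 1 = 1" using ext[OF cl(2)] hom by simp
    ultimately show "y = z" by (cases "?w = 0") auto
  qed
  have surj: "adjoin F x \<subseteq> \<sigma> ` adjoin F x"
  proof
    fix y assume "y \<in> adjoin F x"
    then obtain f where f: "f \<in> polys_over F" "y = poly f x" by (auto simp: adjoin_def)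
    have onto: "\<tau> ` F = F" using \<tau> by (simp add: field_aut_def bij_betw_def)
    \<comment> \<open>The shift by \<open>d\<close> is cancelled by \<open>\<tau> e = d\<close>, so
      \<open>x - e\<close> is a preimage of \<open>x\<close>. A preimage of f(x) is then assembled
      by Horner's scheme.\<close>
    then obtain e where e: "e \<in> F" "d = \<tau> e" using d(1) by auto
    have "\<exists>z\<in>adjoin F x. \<sigma> z = poly f x" using f(1)
    proof (induction f)
      case 0
      show ?case using ext[OF cl(1)] hom(2) adjoin_incl(1) cl(1) by (intro bexI[of _ 0]) auto
    next
      case (pCons c f)
      have c: "c \<in> F" and "f \<in> polys_over F"
        using pCons.prems by (auto simp: polys_over_def coeff_pCons split: nat.splits)
      then obtain z where z: "z \<in> adjoin F x" "\<sigma> z = poly f x" using pCons.IH by blast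
      obtain b where b: "b \<in> F" "c = \<tau> b" using c onto by auto
      note cl' = type_subfield_closed[OF cL]
      have mem: "b \<in> adjoin F x" "e \<in> adjoin F x" using b e adjoin_incl(1) by auto
      have xe: "x - e \<in> adjoin F x" using cl'(6) adjoin_incl(2) mem by blast
      have "\<sigma> (x - e) = x"
        using add[OF xe mem(2)] sx ext[OF e(1)] e(2) by simp
      then have "\<sigma> (b + (x - e) * z) = poly (pCons c f) x"
        using add[OF mem(1) cl'(7)[OF xe z(1)]] mult[OF xe z(1)] z(2) ext[OF b(1)] b(2) by simp
      then show ?case using cl'(5)[OF mem(1) cl'(7)[OF xe z(1)]] by blast
    qed
    then show "y \<in> \<sigma> ` adjoin F x" using f(2) by (metis image_eqI)
  qed
  have "field_aut (adjoin F x) \<sigma>"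
    unfolding field_aut_def bij_betw_def using inj surj into add mult by auto
  then show ?thesis using that[of \<sigma>] ext sx by blast
qed

text \<open>Iterating \<sigma> shows that a representative \<open>f\<close> of degree below
  \<open>p\<close> takes the value \<open>y\<close> at all \<open>p\<close> translates of
  \<open>x\<close>, so \<open>f\<close> is constant.\<close>

lemma artin_schreier_fixed:
  assumes nin: "x \<notin> F" and \<sigma>: "field_aut (adjoin F x) \<sigma>" "\<And>y. y \<in> F \<Longrightarrow> \<sigma> y = y" "\<sigma> x = x + 1"
    and y: "y \<in> adjoin F x" "\<sigma> y = y"
  shows "y \<in> F"
proof -
  note hom = field_aut_hom[OF adjoin_subfield \<sigma>(1)] and cl = type_subfield_closed[OF adjoin_subfield]
  obtain f where f: "f \<in> polys_over F" "degree f < p" "y = poly f x"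
    using adjoin_reduced y(1) by blast
  have step: "\<sigma> (poly g z) = poly g (\<sigma> z)" if "g \<in> polys_over F" "z \<in> adjoin F x" for g z
  proof -
    have "coeff g i \<in> adjoin F x" "\<sigma> (coeff g i) = coeff g i" for i
      using polys_overD[OF that(1)] adjoin_incl(1) \<sigma>(2) by auto
    then show ?thesis unfolding poly_altdef
      using that(2) by (subst field_aut_sum[OF adjoin_subfield \<sigma>(1)]) (auto simp: hom cl)
  qed
  have mem: "x + of_nat i \<in> adjoin F x" for i by (intro cl adjoin_incl(2))
  have it: "poly f (x + of_nat i) = y" for i
  proof (induction i)
    case (Suc i)
    have of_nat_fixed: "\<sigma> (of_nat i) = of_nat i" using \<sigma>(2) type_subfield_closed(10)[OF F] by blast
    have "y = \<sigma> (poly f (x + of_nat i))" using Suc y(2) by simp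
    also have "\<dots> = poly f (\<sigma> (x + of_nat i))" using step[OF f(1) mem] .
    also have "\<sigma> (x + of_nat i) = x + of_nat (Suc i)"
      using hom(4)[OF adjoin_incl(2) cl(10)[of i]] \<sigma>(3) of_nat_fixed by (simp add: ac_simps)
    finally show ?case ..
  qed (simp add: f)
  have "f - [:y:] = 0"
  proof (rule ccontr)
    assume nz: "f - [:y:] \<noteq> 0"
    have "p \<le> card {z. poly (f - [:y:]) z = 0}"
      using artin_schreier_poly_eq_prod(2)[of x] it
        card_mono[OF poly_roots_finite[OF nz], of "(\<lambda>i. x + of_nat i) ` {..<p}"] by fastforce
    moreover have "degree (f - [:y:]) < p"
      using f(2) degree_diff_le[of f "degree f" "[:y:]"] by simp
    ultimately show False using card_poly_roots_bound[OF nz] by linarith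
  qed
  then have "y = coeff f 0" by (metis coeff_pCons_0 right_minus_eq)
  then show ?thesis using polys_overD[OF f(1)] by simp
qed

end
end

subsection \<open>The valuation of a Hahn series field\<close>

lemma hval_ge_iff: "Fin m \<le> hval f \<longleftrightarrow> (\<forall>q<m. hcoeff f q = 0)"
proof (cases "f = 0")
  case True
  then show ?thesis by (simp add: hval_def)
next
  case False
  then obtain n where n: "hval f = Fin n" "hcoeff f n \<noteq> 0" "\<And>q. hcoeff f q \<noteq> 0 \<Longrightarrow> n \<le> q"
    using hval_obtain by blast
  then show ?thesis by (force simp: not_le)
qed

lemma hval_gt_iff: "Fin m < hval f \<longleftrightarrow> (\<forall>q\<le>m. hcoeff f q = 0)"
proof (cases "f = 0")
  case True
  then show ?thesis by (simp add: hval_def)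
next
  case False
  then obtain n where n: "hval f = Fin n" "hcoeff f n \<noteq> 0" "\<And>q. hcoeff f q \<noteq> 0 \<Longrightarrow> n \<le> q"
    using hval_obtain by blast
  then show ?thesis by (force simp: not_le)
qed

lemma hval_0 [simp]: "hval 0 = Pinf"
  by (simp add: hval_def)

lemma hval_eq_Pinf_iff [simp]: "hval f = Pinf \<longleftrightarrow> f = 0"
  by (simp add: hval_def)

lemma hval_finite: "f \<noteq> 0 \<Longrightarrow> \<exists>q. hval f = Fin q"
  by (simp add: hval_def)

lemma hval_FinD: "hval f = Fin q \<Longrightarrow> hcoeff f q \<noteq> 0"
  by (metis extended.distinct(1) extended.inject hval_0 hval_obtain)

lemma hval_hmonom: "c \<noteq> 0 \<Longrightarrow> hval (hmonom c r) = Fin r"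
  by (rule hval_eqI) (auto simp: hcoeff_hmonom split: if_splits)

lemma hval_1 [simp]: "hval (1 :: 'a::comm_ring_1 hahn) = 0"
  unfolding zero_extended_def by (rule hval_eqI) (auto simp: hcoeff_1 split: if_splits)

lemma hval_uminus [simp]: "hval (- f :: 'a::comm_ring_1 hahn) = hval f"
proof (cases "f = 0")
  case False
  then obtain n where n: "hval f = Fin n" "hcoeff f n \<noteq> 0" "\<And>q. hcoeff f q \<noteq> 0 \<Longrightarrow> n \<le> q"
    using hval_obtain by blast
  then show ?thesis using hval_eqI[of "- f" n] by simp
qed simp

lemma hcoeff_mult_leading:
  fixes f g :: "'a::comm_ring_1 hahn"
  assumes "Fin a \<le> hval f" "Fin b \<le> hval g"
  shows "hcoeff (f * g) (a + b) = hcoeff f a * hcoeff g b"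
proof -
  have "hcoeff (f * g) (a + b) = Sum_any (\<lambda>c. if c = a then hcoeff f a * hcoeff g b else 0)"
    unfolding hcoeff_mult
  proof (rule Sum_any.cong)
    fix c :: rat
    show "hcoeff f c * hcoeff g (a + b - c) = (if c = a then hcoeff f a * hcoeff g b else 0)"
      using assms unfolding hval_ge_iff by (cases c a rule: linorder_cases) auto
  qed
  then show ?thesis by simp
qed

lemma hval_mult_ge:
  fixes f g :: "'a::comm_ring_1 hahn"
  assumes "Fin a \<le> hval f" "Fin b \<le> hval g"
  shows "Fin (a + b) \<le> hval (f * g)"
  using assms hcoeff_mult_bound[of f a g b] unfolding hval_ge_iff hsupp_def mem_Collect_eq
  by (meson linorder_not_le)

lemma hval_mult: "hval (f * g :: 'a::field hahn) = hval f + hval g"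
proof (cases "f = 0 \<or> g = 0")
  case True
  have "Pinf + h \<noteq> Minf" "Pinf + h = Pinf" "h + Pinf = Pinf" for h :: "rat extended"
    by (cases h; simp)+
  then show ?thesis using True by auto
next
  case False
  then obtain a b where ab: "hval f = Fin a" "hval g = Fin b" using hval_finite by metis
  then have "hcoeff (f * g) (a + b) \<noteq> 0"
    using hcoeff_mult_leading[of a f b g] hval_FinD by fastforce
  moreover have "Fin (a + b) \<le> hval (f * g)" using hval_mult_ge ab by (metis order_refl)
  then have "a + b \<le> q" if "hcoeff (f * g) q \<noteq> 0" for q
    using that unfolding hval_ge_iff by (meson linorder_not_le)
  ultimately show ?thesis using hval_eqI ab by (metis plus_extended.simps(1))
qed

lemma hval_power: "hval f = Fin q \<Longrightarrow> hval (f ^ n :: 'a::field hahn) = Fin (of_nat n * q)"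
  by (induction n) (simp_all add: hval_mult zero_extended_def algebra_simps)

lemma hval_inverse: "hval f = Fin q \<Longrightarrow> hval (inverse f :: 'a::field hahn) = Fin (- q)"
proof -
  assume q: "hval f = Fin q"
  then have nz: "f \<noteq> 0" by auto
  then obtain r where r: "hval (inverse f) = Fin r" using hval_finite[of "inverse f"] by auto
  have "Fin (q + r) = Fin 0"
    using hval_mult[of f "inverse f"] nz q r by (simp add: zero_extended_def)
  then have "r = - q" by simp
  then show ?thesis using r by simp
qed

lemma hval_divide:
  "hval f = Fin q \<Longrightarrow> hval g = Fin r \<Longrightarrow> hval (f / g :: 'a::field hahn) = Fin (q - r)"
  by (simp add: divide_inverse hval_mult hval_inverse)

lemma hval_integral_closed:
  fixes f g :: "'a::field hahn"
  shows "0 \<le> hval f \<Longrightarrow> 0 \<le> hval g \<Longrightarrow> 0 \<le> hval (f + g)"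
    "0 \<le> hval f \<Longrightarrow> 0 \<le> hval g \<Longrightarrow> 0 \<le> hval (f - g)"
    "0 \<le> hval f \<Longrightarrow> 0 \<le> hval g \<Longrightarrow> 0 \<le> hval (f * g)"
    "0 < hval f \<Longrightarrow> 0 < hval g \<Longrightarrow> 0 < hval (f + g)"
    "0 < hval f \<Longrightarrow> 0 < hval g \<Longrightarrow> 0 < hval (f - g)"
    "0 < hval f \<Longrightarrow> 0 \<le> hval g \<Longrightarrow> 0 < hval (f * g)"
proof -
  show "0 \<le> hval f \<Longrightarrow> 0 \<le> hval g \<Longrightarrow> 0 \<le> hval (f + g)"
    "0 \<le> hval f \<Longrightarrow> 0 \<le> hval g \<Longrightarrow> 0 \<le> hval (f - g)"
    "0 < hval f \<Longrightarrow> 0 < hval g \<Longrightarrow> 0 < hval (f + g)"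
    "0 < hval f \<Longrightarrow> 0 < hval g \<Longrightarrow> 0 < hval (f - g)"
    unfolding zero_extended_def hval_ge_iff hval_gt_iff by simp_all
  show "0 \<le> hval f \<Longrightarrow> 0 \<le> hval g \<Longrightarrow> 0 \<le> hval (f * g)"
    using hval_mult_ge[of 0 f 0 g] by (simp add: zero_extended_def)
  show "0 < hval f \<Longrightarrow> 0 \<le> hval g \<Longrightarrow> 0 < hval (f * g)"
    unfolding hval_mult zero_extended_def by (cases "hval f"; cases "hval g") auto
qed

lemma hval_prod_integral:
  fixes f :: "'b \<Rightarrow> 'a::field hahn"
  assumes "\<And>i. i \<in> A \<Longrightarrow> 0 \<le> hval (f i)"
  shows "0 \<le> hval (prod f A)"
  using assms by (induction A rule: infinite_finite_induct) (auto intro: hval_integral_closed)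

lemma hval_sum_integral:
  fixes f :: "'b \<Rightarrow> 'a::field hahn"
  assumes "\<And>i. i \<in> A \<Longrightarrow> 0 \<le> hval (f i)"
  shows "0 \<le> hval (sum f A)"
  using assms
  by (induction A rule: infinite_finite_induct) (auto intro: hval_integral_closed(1))

lemma hval_prod_pos:
  fixes f :: "'b \<Rightarrow> 'a::field hahn"
  assumes "finite A" "\<And>i. i \<in> A \<Longrightarrow> 0 \<le> hval (f i)" "j \<in> A" "0 < hval (f j)"
  shows "0 < hval (prod f A)"
  using hval_integral_closed(6)[OF assms(4) hval_prod_integral[of "A - {j}" f]] assms
  by (simp add: prod.remove[of A j f])

lemma hval_prod_units:
  fixes f :: "'b \<Rightarrow> 'a::field hahn"
  assumes "\<And>i. i \<in> A \<Longrightarrow> hval (f i) = 0"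
  shows "hval (prod f A) = 0"
  using assms by (induction A rule: infinite_finite_induct) (auto simp: hval_mult)

text \<open>On the valuation ring the coefficient at exponent 0 is the residue, so residues can be
  compared without forming a quotient ring.\<close>

lemma hval_eq_0_iff: "hval f = 0 \<longleftrightarrow> 0 \<le> hval f \<and> hcoeff f 0 \<noteq> 0"
proof
  assume "hval f = 0"
  then show "0 \<le> hval f \<and> hcoeff f 0 \<noteq> 0" using hval_FinD by (simp add: zero_extended_def)
next
  assume *: "0 \<le> hval f \<and> hcoeff f 0 \<noteq> 0"
  then show "hval f = 0"
    unfolding zero_extended_def hval_ge_iff by (intro hval_eqI) (auto simp: not_less[symmetric])
qed

lemma hval_pos_iff: "0 < hval f \<longleftrightarrow> 0 \<le> hval f \<and> hcoeff f 0 = 0"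
  unfolding zero_extended_def hval_ge_iff hval_gt_iff by (auto simp: order_le_less)

lemma residue_one:
  fixes f :: "'a::field hahn"
  assumes "0 < hval (f - 1)"
  shows "hval f = 0"
proof -
  have "0 \<le> hval ((f - 1) + 1)" using assms by (intro hval_integral_closed(1)) auto
  moreover have "hcoeff (f - 1) 0 = 0" using assms by (simp add: hval_pos_iff)
  ultimately show ?thesis by (simp add: hval_eq_0_iff hcoeff_1)
qed

lemma hcoeff_prod_residue:
  fixes f :: "'b \<Rightarrow> 'a::field hahn"
  assumes "\<And>i. i \<in> A \<Longrightarrow> 0 \<le> hval (f i)"
  shows "hcoeff (prod f A) 0 = (\<Prod>i\<in>A. hcoeff (f i) 0)"
  using assms
proof (induction A rule: infinite_finite_induct)
  case (insert a A)
  then show ?case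
    using hcoeff_mult_leading[of 0 "f a" 0 "prod f A"] hval_prod_integral[of A f]
    by (simp add: zero_extended_def)
qed (simp_all add: hcoeff_1)

lemma hval_add_strict:
  fixes f g :: "'a::field hahn"
  assumes "hval f < hval g"
  shows "hval (f + g) = hval f"
proof -
  have "f \<noteq> 0" using assms by auto
  then obtain n where n: "hval f = Fin n" "hcoeff f n \<noteq> 0" "\<And>q. hcoeff f q \<noteq> 0 \<Longrightarrow> n \<le> q"
    using hval_obtain by blast
  have g: "\<And>q. q \<le> n \<Longrightarrow> hcoeff g q = 0" using assms n(1) by (simp add: hval_gt_iff)
  have "hval (f + g) = Fin n"
  proof (rule hval_eqI)
    show "n \<le> q" if "hcoeff (f + g) q \<noteq> 0" for q
      using that g[of q] n(3)[of q] by (cases "q \<le> n") auto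
  qed (use n g in auto)
  then show ?thesis using n by simp
qed

lemma coeff_prod_linear_integral:
  fixes S :: "'a::field hahn set"
  assumes "finite S" "\<And>z. z \<in> S \<Longrightarrow> 0 \<le> hval z"
  shows "0 \<le> hval (coeff (\<Prod>z\<in>S. [:- z, 1:]) i)"
  using assms
proof (induction S arbitrary: i rule: finite_induct)
  case empty
  then show ?case by (auto simp: coeff_1 zero_extended_def)
next
  case (insert a S)
  have "0 \<le> hval (- a * coeff (\<Prod>z\<in>S. [:- z, 1:]) i)"
    using insert by (intro hval_integral_closed) auto
  moreover have "0 \<le> hval (coeff (pCons 0 (\<Prod>z\<in>S. [:- z, 1:])) i)"
    using insert by (auto simp: coeff_pCons zero_extended_def split: nat.splits)
  moreover have "coeff (\<Prod>z\<in>insert a S. [:- z, 1:]) i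
     = - a * coeff (\<Prod>z\<in>S. [:- z, 1:]) i + coeff (pCons 0 (\<Prod>z\<in>S. [:- z, 1:])) i"
    using insert by simp
  ultimately show ?case using hval_integral_closed(1) by metis
qed

lemma hval_poly_integral:
  fixes f :: "'a::field hahn poly"
  assumes "\<And>i. 0 \<le> hval (coeff f i)" "0 \<le> hval x"
  shows "0 \<le> hval (poly f x)"
proof -
  have "0 \<le> hval (x ^ n)" for n
    using assms(2) by (induction n) (auto intro: hval_integral_closed)
  then show ?thesis unfolding poly_altdef
    by (intro hval_sum_integral hval_integral_closed assms)
qed

lemma hval_of_nat: "0 \<le> hval (of_nat n :: 'a::field hahn)"
  unfolding zero_extended_def hval_ge_iff by (simp add: hcoeff_of_nat)

text \<open>If \<open>x\<close> had nonnegative value, \<open>a\<close> would be integral. So the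
  value of \<open>x\<close> is negative, \<open>x ^ n\<close> dominates \<open>x\<close>, and
  \<open>x ^ n\<close> has the value of \<open>a\<close>.\<close>

lemma hval_artin_schreier_root:
  fixes x a :: "'a::field hahn"
  assumes "1 < n" "x ^ n - x = a" "hval a = Fin q" "q < 0"
  shows "hval x = Fin (q / of_nat n)"
proof -
  have "x \<noteq> 0" using assms by (auto simp: power_0_left)
  then obtain r where r: "hval x = Fin r" using hval_finite by blast
  have pw: "hval (x ^ n) = Fin (of_nat n * r)" using r by (rule hval_power)
  have n: "(1::rat) < of_nat n" using assms(1) by simp
  have "r < 0"
  proof (rule ccontr)
    assume "\<not> r < 0"
    then have "0 \<le> hval (x ^ n - x)" using r pw by (intro hval_integral_closed) (auto simp: zero_extended_def)
    then show False using assms by (simp add: zero_extended_def)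
  qed
  then have "of_nat n * r < r" using n by (simp add: field_simps)
  then have "hval (x ^ n + - x) = Fin (of_nat n * r)" using pw r by (subst hval_add_strict) auto
  then have "q = of_nat n * r" using assms(2,3) by simp
  then show ?thesis using r n by simp
qed

subsection \<open>Galois action on a Henselian field\<close>

text \<open>\<open>ident\<close> and \<open>comp\<close> ask for agreement on \<open>N\<close> only,
  so that extensional automorphisms satisfy them. Finite orbits are what the polynomial of the
  conjugates of an element requires.\<close>

locale hahn_galois =
  fixes N K :: "'a::field hahn set" and G :: "('a hahn \<Rightarrow> 'a hahn) set"
  assumes N: "type_subfield N" and K: "type_subfield K"
    and aut: "\<And>\<sigma>. \<sigma> \<in> G \<Longrightarrow> field_aut N \<sigma>"
    and fixes_K: "\<And>\<sigma> x. \<sigma> \<in> G \<Longrightarrow> x \<in> K \<Longrightarrow> \<sigma> x = x"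
    and K_sub: "K \<subseteq> N"
    and fixed: "\<And>x. x \<in> N \<Longrightarrow> (\<And>\<sigma>. \<sigma> \<in> G \<Longrightarrow> \<sigma> x = x) \<Longrightarrow> x \<in> K"
    and finite_orbit: "\<And>x. x \<in> N \<Longrightarrow> finite ((\<lambda>\<sigma>. \<sigma> x) ` G)"
    and ident: "\<exists>\<rho>\<in>G. \<forall>x\<in>N. \<rho> x = x"
    and comp: "\<And>\<sigma> \<tau>. \<sigma> \<in> G \<Longrightarrow> \<tau> \<in> G \<Longrightarrow> \<exists>\<rho>\<in>G. \<forall>x\<in>N. \<rho> x = \<sigma> (\<tau> x)"
    and hensel: "henselian hval K"
    and K_const: "range hconst \<subseteq> K" and K_var: "hvar \<in> K"
begin

definition orbit :: "'a hahn \<Rightarrow> 'a hahn set"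
  where "orbit x = (\<lambda>\<sigma>. \<sigma> x) ` G"

lemmas hom = field_aut_hom[OF N aut]

lemma orbit_props:
  assumes x: "x \<in> N"
  shows "finite (orbit x)" "orbit x \<subseteq> N" "x \<in> orbit x"
    "\<And>\<sigma>. \<sigma> \<in> G \<Longrightarrow> \<sigma> x \<in> orbit x"
    "\<And>\<tau>. \<tau> \<in> G \<Longrightarrow> \<tau> ` orbit x = orbit x"
    "\<And>\<tau>. \<tau> \<in> G \<Longrightarrow> inj_on \<tau> N"
proof -
  show fin: "finite (orbit x)" using finite_orbit[OF x] by (simp add: orbit_def)
  show sub: "orbit x \<subseteq> N" using x hom(1) by (auto simp: orbit_def)
  show "x \<in> orbit x" using ident x by (metis imageI orbit_def)
  show "\<And>\<sigma>. \<sigma> \<in> G \<Longrightarrow> \<sigma> x \<in> orbit x" by (auto simp: orbit_def)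
  show inj: "inj_on \<tau> N" if "\<tau> \<in> G" for \<tau>
    using aut[OF that] by (simp add: field_aut_def bij_betw_def)
  show "\<tau> ` orbit x = orbit x" if "\<tau> \<in> G" for \<tau>
  proof (rule endo_inj_surj[OF fin])
    show "\<tau> ` orbit x \<subseteq> orbit x"
    proof
      fix z assume "z \<in> \<tau> ` orbit x"
      then obtain \<sigma> where "\<sigma> \<in> G" "z = \<tau> (\<sigma> x)" by (auto simp: orbit_def)
      then show "z \<in> orbit x" using comp[OF that, of \<sigma>] x unfolding orbit_def by (metis imageI)
    qed
    show "inj_on \<tau> (orbit x)" using inj_on_subset[OF inj[OF that] sub] .
  qed
qed

section \<open>Residues of conjugates and Hensel's Lemma\<close>

lemma orbit_poly_over_K:
  assumes x: "x \<in> N"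
  shows "(\<Prod>z\<in>orbit x. [:- z, 1:]) \<in> polys_over K"
proof -
  note pcl = polys_over_closed[OF N] and cl = type_subfield_closed[OF N]
  have prod: "(\<Prod>z\<in>S. [:- z, 1:]) \<in> polys_over N \<and>
      map_poly \<tau> (\<Prod>z\<in>S. [:- z, 1:]) = (\<Prod>z\<in>S. [:- \<tau> z, 1:])"
    if "finite S" "S \<subseteq> N" "\<tau> \<in> G" for S \<tau>
    using that(1,2)
  proof (induction S rule: finite_induct)
    case empty
    have "1 \<in> polys_over N" using cl by (simp add: polys_over_def coeff_1)
    moreover have "map_poly \<tau> 1 = 1"
      using hom(2,3)[OF that(3)] by (intro poly_eqI) (simp add: coeff_map_poly coeff_1)
    ultimately show ?case by simp
  next
    case (insert a S)
    have l: "[:- a, 1:] \<in> polys_over N" using insert cl pcl by simp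
    have ml: "map_poly \<tau> [:- a, 1:] = [:- \<tau> a, 1:]"
      using hom(2,3)[OF that(3)] hom(6)[OF that(3), of a] insert.prems
      by (intro poly_eqI) (auto simp: coeff_map_poly coeff_pCons split: nat.splits)
    have IH: "(\<Prod>z\<in>S. [:- z, 1:]) \<in> polys_over N"
      "map_poly \<tau> (\<Prod>z\<in>S. [:- z, 1:]) = (\<Prod>z\<in>S. [:- \<tau> z, 1:])"
      using insert by auto
    show ?case
      unfolding prod.insert[OF insert.hyps] map_poly_field_aut(3)[OF N aut[OF that(3)] l IH(1)] ml IH(2)
      using pcl(5)[OF l IH(1)] by simp
  qed
  let ?f = "\<Prod>z\<in>orbit x. [:- z, 1:]"
  note orb = orbit_props[OF x]
  \<comment> \<open>The automorphisms permute the factors, so each coefficient is fixed by all of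
    them.\<close>
  show ?thesis
    unfolding polys_over_def
  proof (intro CollectI allI, rule fixed)
    fix i
    obtain \<rho> where "\<rho> \<in> G" using ident by blast
    then show "coeff ?f i \<in> N" using prod[OF orb(1,2)] polys_overD by blast
    fix \<sigma> assume \<sigma>: "\<sigma> \<in> G"
    have "\<sigma> (coeff ?f i) = coeff (map_poly \<sigma> ?f) i"
      using hom(2)[OF \<sigma>] by (simp add: coeff_map_poly)
    also have "map_poly \<sigma> ?f = (\<Prod>z\<in>orbit x. [:- \<sigma> z, 1:])"
      using prod[OF orb(1,2) \<sigma>] by simp
    also have "\<dots> = (\<Prod>z\<in>\<sigma> ` orbit x. [:- z, 1:])"
      using inj_on_subset[OF orb(6)[OF \<sigma>] orb(2)] by (simp add: prod.reindex)
    also have "\<sigma> ` orbit x = orbit x" using orb(5)[OF \<sigma>] .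
    finally show "\<sigma> (coeff ?f i) = coeff ?f i" .
  qed
qed

text \<open>If \<open>y\<close> is the only conjugate outside the maximal ideal, then \<open>1\<close> is a simple root
  modulo the maximal ideal of the polynomial with roots the conjugates of \<open>y\<close>.\<close>
lemma isolated_residue_in_K:
  assumes y: "y \<in> N" "0 < hval (y - 1)" and others: "\<And>z. z \<in> orbit y \<Longrightarrow> z \<noteq> y \<Longrightarrow> 0 < hval z"
  shows "y \<in> K"
proof -
  note orb = orbit_props[OF y(1)]
  let ?f = "\<Prod>z\<in>orbit y. [:- z, 1:]" and ?g = "\<Prod>z\<in>orbit y - {y}. [:- z, 1:]"
  have hy: "hval y = 0" using residue_one[OF y(2)] .
  have int: "0 \<le> hval z" if "z \<in> orbit y" for z
    using others[OF that] hy by (cases "z = y") auto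
  have f: "?f = [:- y, 1:] * ?g" using prod.remove[OF orb(1,3)] .
  have unit: "hval (1 - z) = 0" if "z \<in> orbit y - {y}" for z
  proof (rule residue_one)
    show "0 < hval (1 - z - 1)" using others[of z] that by simp
  qed
  then have g1: "hval (poly ?g 1) = 0"
    using hval_prod_units[of "orbit y - {y}" "\<lambda>z. 1 - z"] by (simp add: poly_prod)
  have dg: "0 \<le> hval (poly (pderiv ?g) 1)"
  proof (rule hval_poly_integral)
    fix i
    show "0 \<le> hval (coeff (pderiv ?g) i)"
      unfolding coeff_pderiv using orb(1) int
      by (intro hval_integral_closed(3) hval_of_nat coeff_prod_linear_integral) auto
  qed simp
  have y1: "0 < hval (1 - y)" using y(2) hval_uminus[of "y - 1"] by simp
  \<comment> \<open>The first summand is a unit and the second lies in the maximal ideal: 1 is a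
    simple residual root.\<close>
  have "poly (pderiv ?f) 1 = poly ?g 1 + (1 - y) * poly (pderiv ?g) 1"
    unfolding f pderiv_mult by (simp add: pderiv_pCons algebra_simps)
  moreover have "0 < hval ((1 - y) * poly (pderiv ?g) 1)" using y1 dg by (rule hval_integral_closed(6))
  ultimately have d: "hval (poly (pderiv ?f) 1) = 0" using hval_add_strict g1 by metis
  have "poly ?f 1 = (1 - y) * poly ?g 1" unfolding f by (simp add: algebra_simps)
  then have f1: "0 < hval (poly ?f 1)" using hval_integral_closed(6)[OF y1, of "poly ?g 1"] g1 by simp
  have "coeff ?f i \<in> valuation_ring hval K" for i
    using polys_overD[OF orbit_poly_over_K[OF y(1)]] coeff_prod_linear_integral[OF orb(1) int]
    by (simp add: valuation_ring_def)
  moreover have "1 \<in> valuation_ring hval K"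
    using type_subfield_closed(2)[OF K] by (simp add: valuation_ring_def)
  ultimately obtain a where a: "a \<in> K" "poly ?f a = 0" "0 < hval (a - 1)"
    using hensel f1 d unfolding henselian_def valuation_ring_def by blast
  \<comment> \<open>The root \<open>a\<close> is a conjugate of \<open>y\<close> of value 0, while
    all conjugates other than \<open>y\<close> have positive value.\<close>
  have "a \<in> orbit y" using a(2) orb(1) by (auto simp: poly_prod)
  moreover have "hval a = 0" using residue_one[OF a(3)] .
  ultimately have "a = y" using others[of a] by fastforce
  then show ?thesis using a(1) by simp
qed

text \<open>Isolation is achieved by multiplying. Let \<open>u\<close> be the product of the set
  \<open>A\<close> of all conjugates with residue 1. It has residue 1, and an automorphism either
  permutes \<open>A\<close> and fixes \<open>u\<close>, or brings in a factor from the maximal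
  ideal. So \<open>u\<close> is isolated and lies in \<open>K\<close>. Being fixed, it forces every
  automorphism to permute \<open>A\<close>, which contains \<open>y\<close>.\<close>

lemma residue_zero_one:
  assumes y: "y \<in> N" "0 < hval (y - 1)" and zo: "\<And>z. z \<in> orbit y \<Longrightarrow> 0 < hval z \<or> 0 < hval (z - 1)"
    and z: "z \<in> orbit y"
  shows "0 < hval (z - 1)"
proof -
  note orb = orbit_props[OF y(1)]
  define A where "A = {z \<in> orbit y. 0 < hval (z - 1)}"
  have A: "finite A" "A \<subseteq> orbit y" "y \<in> A" using orb y by (auto simp: A_def)
  have unit: "hval z = 0" if "z \<in> A" for z
    using that residue_one[of z] by (simp add: A_def)
  have int: "0 \<le> hval z" if "z \<in> orbit y" for z using zo[OF that] residue_one by fastforce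
  define u where "u = \<Prod>A"
  have u: "u \<in> N" unfolding u_def using A orb by (intro type_subfield_prod[OF N]) auto
  have img: "\<tau> u = \<Prod>(\<tau> ` A)" if "\<tau> \<in> G" for \<tau>
  proof -
    have "inj_on \<tau> A" using inj_on_subset[OF orb(6)[OF that]] A orb(2) by blast
    then show ?thesis
      unfolding u_def using A orb(2) by (subst field_aut_prod[OF N aut[OF that]]) (auto simp: prod.reindex)
  qed
  have dich: "\<tau> ` A = A \<or> 0 < hval (\<tau> u)" if "\<tau> \<in> G" for \<tau>
  proof (cases "\<tau> ` A \<subseteq> A")
    case True
    then show ?thesis
      using endo_inj_surj[OF A(1)] inj_on_subset[OF orb(6)[OF that]] A orb(2) by (metis subset_trans)
  next
    case False
    have sub: "\<tau> ` A \<subseteq> orbit y" using orb(5)[OF that] A by blast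
    obtain z where "z \<in> \<tau> ` A" "z \<notin> A" using False by blast
    moreover from this have "0 < hval z" using sub zo[of z] by (auto simp: A_def)
    ultimately have "0 < hval (\<Prod>(\<tau> ` A))"
      using A(1) sub int by (intro hval_prod_pos[of _ _ z]) auto
    then show ?thesis using img[OF that] by simp
  qed
  have "0 < hval (u - 1)"
  proof -
    have "0 \<le> hval u" unfolding u_def using A int by (intro hval_prod_integral) auto
    then have "0 \<le> hval (u - 1)" by (intro hval_integral_closed(2)) auto
    moreover have "hcoeff u 0 = 1"
    proof -
      have "hcoeff u 0 = (\<Prod>z\<in>A. hcoeff z 0)"
        unfolding u_def using A int by (intro hcoeff_prod_residue) auto
      also have "\<dots> = 1"
      proof (rule prod.neutral, rule ballI)
        show "hcoeff z 0 = 1" if "z \<in> A" for z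
          using that by (auto simp: A_def hval_pos_iff hcoeff_1)
      qed
      finally show ?thesis .
    qed
    ultimately show ?thesis by (simp add: hval_pos_iff hcoeff_1)
  qed
  moreover have "0 < hval w" if "w \<in> orbit u" "w \<noteq> u" for w
  proof -
    obtain \<sigma> where \<sigma>: "\<sigma> \<in> G" "w = \<sigma> u" using \<open>w \<in> orbit u\<close> by (auto simp: orbit_def)
    then have "\<sigma> ` A \<noteq> A" using img[OF \<sigma>(1)] \<open>w \<noteq> u\<close> u_def by auto
    then show ?thesis using dich[OF \<sigma>(1)] \<sigma>(2) by simp
  qed
  ultimately have "u \<in> K" using isolated_residue_in_K[OF u] by blast
  obtain \<tau> where \<tau>: "\<tau> \<in> G" "z = \<tau> y" using z by (auto simp: orbit_def)
  have "hval (\<tau> u) = 0"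
    using fixes_K[OF \<tau>(1) \<open>u \<in> K\<close>] residue_one[OF \<open>0 < hval (u - 1)\<close>] by simp
  then have "\<tau> ` A = A" using dich[OF \<tau>(1)] by simp
  then show ?thesis using A(3) \<tau>(2) by (auto simp: A_def)
qed

section \<open>Values under conjugation\<close>

lemma K_value: "\<exists>c\<in>K. hval c = Fin (of_int m)"
proof (cases "m \<ge> 0")
  case True
  have "hval (hvar ^ nat m :: 'a hahn) = Fin (of_nat (nat m) * 1)"
    by (rule hval_power[OF hval_hmonom]) simp
  then show ?thesis
    using True type_subfield_closed(9)[OF K K_var] by (intro bexI[of _ "hvar ^ nat m"]) auto
next
  case False
  have "hval (hvar ^ nat (- m) :: 'a hahn) = Fin (of_nat (nat (- m)) * 1)"
    by (rule hval_power[OF hval_hmonom]) simp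
  then have "hval (inverse (hvar ^ nat (- m)) :: 'a hahn) = Fin (of_int m)"
    using False by (simp add: hval_inverse)
  then show ?thesis
    using type_subfield_closed(4)[OF K type_subfield_closed(9)[OF K K_var]] by blast
qed

text \<open>A conjugate of smaller value is separated from \<open>b\<close> by \<open>y = 1 / (1 + b\<^sup>n / c)\<close>, for suitable
  \<open>n\<close> and \<open>c\<close>, all of whose conjugates have residue \<open>0\<close> or \<open>1\<close>.\<close>
lemma hval_conjugate_not_less:
  assumes \<sigma>: "\<sigma> \<in> G" and b: "b \<in> N"
  shows "\<not> hval (\<sigma> b) < hval b"
proof
  assume less: "hval (\<sigma> b) < hval b"
  note cl = type_subfield_closed[OF N]
  have b0: "b \<noteq> 0" using less hom(2)[OF \<sigma>] by auto
  then have "\<sigma> b \<noteq> 0" using hom(8)[OF \<sigma> b] by simp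
  obtain s t where st: "hval (\<sigma> b) = Fin s" "hval b = Fin t" "s < t"
    using less b0 hval_finite[of b] hval_finite[OF \<open>\<sigma> b \<noteq> 0\<close>] by auto
  define V where "V = {r. \<exists>z\<in>orbit b. hval z = Fin r}"
  have "Fin ` V \<subseteq> hval ` orbit b"
  proof
    fix e assume "e \<in> Fin ` V"
    then obtain z where "z \<in> orbit b" "e = hval z" unfolding V_def by fastforce
    then show "e \<in> hval ` orbit b" by simp
  qed
  then have "finite (Fin ` V)" using orbit_props(1)[OF b] finite_subset by blast
  then have "finite V" by (rule finite_imageD) (simp add: inj_on_def)
  \<comment> \<open>This \<open>r\<close> separates the two values and avoids the values of all
    conjugates of \<open>b\<close>, so no conjugate of \<open>w\<close> below has value 0.\<close>
  then obtain r where r: "s < r" "r < t" "r \<notin> V"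
    using infinite_Ioo[OF st(3)] by (metis finite_subset greaterThanLessThan_iff subsetI)
  obtain m n where mn: "quotient_of r = (m, n)" by (cases "quotient_of r")
  then have n: "n > 0" and rmn: "r = of_int m / of_int n"
    by (auto intro: quotient_of_denom_pos quotient_of_div)
  obtain c where c: "c \<in> K" "hval c = Fin (of_int m)" using K_value by blast
  have cN: "c \<in> N" using c K_sub by blast
  \<comment> \<open>The power \<open>n\<close> clears the denominator of \<open>r = m / n\<close>,
    because \<open>K_value\<close> supplies integral values only.\<close>
  define w where "w = b ^ nat n / c"
  have w: "w \<in> N" unfolding w_def by (intro cl b cN)
  have n': "(of_nat (nat n) :: rat) = of_int n" "(of_int n :: rat) > 0" using n by auto
  have val: "hval (\<tau> w) = Fin (of_int n * (q - r))" if "\<tau> \<in> G" "hval (\<tau> b) = Fin q" for \<tau> q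
  proof -
    have "\<tau> w = (\<tau> b) ^ nat n / c"
      unfolding w_def using hom(10)[OF that(1) cl(9)[OF b] cN] hom(11)[OF that(1) b] fixes_K[OF that(1) c(1)]
      by simp
    then show ?thesis
      using hval_divide[OF hval_power[OF that(2)] c(2), of "nat n"] n' by (simp add: rmn algebra_simps)
  qed
  define y where "y = 1 / (1 + w)"
  have residue: "0 < hval (1 / (1 + v) - 1)" if v: "0 < hval v" for v :: "'a hahn"
  proof -
    have "hval (1 + v) = 0" using hval_add_strict[of 1 v] v by simp
    then have "hval (inverse (1 + v)) = 0" "1 + v \<noteq> 0" by (auto simp: zero_extended_def dest: hval_inverse)
    then show ?thesis
      using hval_integral_closed(6)[of "- v" "inverse (1 + v)"] v
      by (simp add: divide_simps)
  qed
  have small: "0 < hval (1 / (1 + v))" if v: "hval v = Fin q" "q < 0" for v :: "'a hahn" and q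
  proof -
    have "hval (v + 1) = Fin q" using hval_add_strict[of v 1] v by (simp add: zero_extended_def)
    then have "hval (inverse (1 + v)) = Fin (- q)" by (simp add: hval_inverse add.commute)
    then show ?thesis using v by (simp add: zero_extended_def divide_inverse)
  qed
  have yN: "y \<in> N" unfolding y_def by (intro cl w)
  have y\<tau>: "\<tau> y = 1 / (1 + \<tau> w)" if "\<tau> \<in> G" for \<tau>
    unfolding y_def using hom(10)[OF that cl(2) cl(5)[OF cl(2) w]] hom(4)[OF that cl(2) w] hom(3)[OF that] by simp
  have zo: "0 < hval z \<or> 0 < hval (z - 1)" if z: "z \<in> orbit y" for z
  proof -
    obtain \<tau> where \<tau>: "\<tau> \<in> G" "z = \<tau> y" using z by (auto simp: orbit_def)
    obtain q where q: "hval (\<tau> b) = Fin q"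
      using hval_finite[of "\<tau> b"] hom(8)[OF \<tau>(1) b] b0 by auto
    have "q \<noteq> r" using r(3) q orbit_props(4)[OF b \<tau>(1)] by (auto simp: V_def)
    then consider "of_int n * (q - r) < 0" | "of_int n * (q - r) > 0"
      using n'(2) by (auto simp: mult_less_0_iff zero_less_mult_iff neq_iff)
    then show ?thesis
      using small[OF val[OF \<tau>(1) q]] residue[of "\<tau> w"] val[OF \<tau>(1) q] \<tau>(2) y\<tau>[OF \<tau>(1)]
      by cases (auto simp: zero_extended_def)
  qed
  obtain \<rho> where \<rho>: "\<rho> \<in> G" "\<forall>x\<in>N. \<rho> x = x" using ident by blast
  have "0 < of_int n * (t - r)" using n' r by simp
  then have "0 < hval w" using val[OF \<rho>(1), of t] \<rho>(2) b w st by (simp add: zero_extended_def)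
  then have "0 < hval (y - 1)" unfolding y_def by (rule residue)
  \<comment> \<open>All conjugates of \<open>y\<close> share the residue 1 of \<open>y\<close>. But
    \<sigma> w has negative value, which gives \<sigma> y the residue 0.\<close>
  then have "0 < hval (\<sigma> y - 1)"
    using residue_zero_one[OF yN _ zo] orbit_props(4)[OF yN \<sigma>] by blast
  then have "hval (\<sigma> y) = 0" by (rule residue_one)
  moreover have "of_int n * (s - r) < 0" using n' r by (simp add: mult_less_0_iff)
  then have "0 < hval (\<sigma> y)" using small[OF val[OF \<sigma> st(1)]] y\<tau>[OF \<sigma>] by simp
  ultimately show False by simp
qed

text \<open>Inversion reverses the order of values, so the inequality for \<open>inverse b\<close>
  excludes an increase as well.\<close>

lemma hval_conjugate:
  assumes \<sigma>: "\<sigma> \<in> G" and b: "b \<in> N"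
  shows "hval (\<sigma> b) = hval b"
proof (cases "b = 0")
  case True
  then show ?thesis using hom(2)[OF \<sigma>] by simp
next
  case False
  then obtain q r where qr: "hval b = Fin q" "hval (\<sigma> b) = Fin r"
    using hval_finite[of b] hval_finite[of "\<sigma> b"] hom(8)[OF \<sigma> b] by auto
  have "\<not> r < q" using hval_conjugate_not_less[OF \<sigma> b] qr by simp
  moreover have "\<not> - r < - q"
    using hval_conjugate_not_less[OF \<sigma> type_subfield_closed(4)[OF N b]] hom(9)[OF \<sigma> b]
      hval_inverse[OF qr(1)] hval_inverse[OF qr(2)] by simp
  ultimately show ?thesis using qr by simp
qed

text \<open>The residue of \<open>\<sigma> b / b\<close> is a root of unity of order a power of the characteristic.\<close>
lemma hval_conjugate_diff:
  assumes \<sigma>: "\<sigma> \<in> G" and pr: "Factorial_Ring.prime CHAR('a)"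
    and ord: "\<And>x. x \<in> N \<Longrightarrow> (\<sigma> ^^ (CHAR('a) ^ k)) x = x"
    and b: "b \<in> N" "b \<noteq> 0"
  shows "0 < hval ((\<sigma> b - b) / b)"
proof -
  note cl = type_subfield_closed[OF N]
  let ?n = "CHAR('a) ^ k"
  have b\<sigma>: "\<sigma> b \<in> N" "\<sigma> b \<noteq> 0" using hom(1,8)[OF \<sigma>] b by auto
  define u where "u = \<sigma> b / b"
  have u: "u \<in> N" unfolding u_def by (intro cl b(1) b\<sigma>(1))
  obtain q where "hval b = Fin q" "hval (\<sigma> b) = Fin q"
    using hval_conjugate[OF \<sigma> b(1)] hval_finite[OF b(2)] by auto
  then have u0: "hval u = 0" using hval_divide[of "\<sigma> b" q b q] by (simp add: u_def zero_extended_def)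
  \<comment> \<open>All iterates of \<open>u\<close> have the same residue: subtracting the constant
    \<open>hcoeff u 0\<close>, which lies in \<open>K\<close>, leaves an element of the maximal
    ideal, and \<sigma> preserves its value.\<close>
  have iter: "(\<sigma> ^^ i) u \<in> N \<and> (\<sigma> ^^ i) b \<in> N \<and> (\<sigma> ^^ i) b \<noteq> 0 \<and> (\<sigma> ^^ i) u = (\<sigma> ^^ Suc i) b / (\<sigma> ^^ i) b
     \<and> 0 \<le> hval ((\<sigma> ^^ i) u) \<and> hcoeff ((\<sigma> ^^ i) u) 0 = hcoeff u 0" for i
  proof (induction i)
    case 0
    then show ?case using u b u0 by (simp add: u_def)
  next
    case (Suc i)
    let ?c = "hconst (hcoeff u 0)" and ?v = "(\<sigma> ^^ i) u"
    have c: "?c \<in> K" "?c \<in> N" using K_const K_sub by auto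
    have v: "?v \<in> N" using Suc by blast
    have nn: "(\<sigma> ^^ Suc i) b \<in> N" "(\<sigma> ^^ Suc i) b \<noteq> 0" using Suc hom(1,8)[OF \<sigma>] by auto
    have "0 < hval (?v - ?c)"
    proof -
      have "0 \<le> hval ?c" unfolding zero_extended_def hval_ge_iff by (simp add: hcoeff_hmonom)
      then have "0 \<le> hval (?v - ?c)" using Suc by (intro hval_integral_closed(2)) auto
      moreover have "hcoeff ?v 0 = hcoeff u 0" using Suc by blast
      then have "hcoeff (?v - ?c) 0 = 0" by (simp only: hcoeff_diff hcoeff_hmonom) simp
      ultimately show ?thesis by (simp only: hval_pos_iff)
    qed
    then have "0 < hval (\<sigma> ?v - ?c)"
      using hval_conjugate[OF \<sigma> cl(6)[OF v c(2)]] hom(7)[OF \<sigma> v c(2)] fixes_K[OF \<sigma> c(1)] by simp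
    then have "hcoeff (\<sigma> ?v) 0 = hcoeff u 0" by (simp add: hval_pos_iff hcoeff_hmonom)
    moreover have "0 \<le> hval ?v" using Suc by blast
    then have "0 \<le> hval (\<sigma> ?v)" by (simp only: hval_conjugate[OF \<sigma> v])
    moreover have "\<sigma> ?v = (\<sigma> ^^ Suc (Suc i)) b / (\<sigma> ^^ Suc i) b"
      using Suc hom(10)[OF \<sigma> nn(1), of "(\<sigma> ^^ i) b"] by simp
    ultimately show ?case using nn hom(1)[OF \<sigma> v] by simp
  qed
  have tele: "(\<Prod>i<n. (\<sigma> ^^ i) u) = (\<sigma> ^^ n) b / b" for n
  proof (induction n)
    case (Suc n)
    have "(\<Prod>i<Suc n. (\<sigma> ^^ i) u) = ((\<sigma> ^^ n) b / b) * ((\<sigma> ^^ Suc n) b / (\<sigma> ^^ n) b)"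
      using Suc iter[of n] by simp
    then show ?case using iter[of n] by simp
  qed (use b in simp)
  have "hcoeff ((\<sigma> ^^ i) u) 0 = hcoeff u 0" for i using iter by blast
  then have "hcoeff u 0 ^ ?n = (\<Prod>i<?n. hcoeff ((\<sigma> ^^ i) u) 0)"
    by (simp only: prod_constant card_lessThan)
  also have "\<dots> = hcoeff (\<Prod>i<?n. (\<sigma> ^^ i) u) 0"
    using iter by (intro hcoeff_prod_residue[symmetric]) blast
  also have "\<dots> = 1" using tele[of ?n] ord[OF b(1)] b by (simp add: hcoeff_1)
  finally have "hcoeff u 0 ^ ?n = 1" .
  \<comment> \<open>By additivity of the Frobenius power, \<open>hcoeff u 0 - 1\<close> is nilpotent
    and hence 0.\<close>
  moreover have "(hcoeff u 0 - 1 + 1) ^ ?n = (hcoeff u 0 - 1) ^ ?n + 1 ^ ?n"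
    using pr by (intro freshmans_dream') auto
  ultimately have "(hcoeff u 0 - 1) ^ ?n = 0" by simp
  then have "hcoeff u 0 = 1" by simp
  moreover have "0 \<le> hval (u - 1)" using u0 by (intro hval_integral_closed(2)) auto
  ultimately have "0 < hval (u - 1)" by (simp add: hval_pos_iff hcoeff_1)
  then show ?thesis using b by (simp add: u_def diff_divide_distrib)
qed

end

subsection \<open>Galois groups\<close>

lemma gal_iff:
  assumes L: "type_subfield L"
  shows "\<sigma> \<in> gal L K \<longleftrightarrow> \<sigma> \<in> extensional L \<and> field_aut L \<sigma> \<and> (\<forall>x\<in>K. \<sigma> x = x)"
proof
  assume "\<sigma> \<in> gal L K"
  then show "\<sigma> \<in> extensional L \<and> field_aut L \<sigma> \<and> (\<forall>x\<in>K. \<sigma> x = x)"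
    by (auto simp: gal_def Bij_def field_aut_def Ring.ring_hom_def)
next
  assume *: "\<sigma> \<in> extensional L \<and> field_aut L \<sigma> \<and> (\<forall>x\<in>K. \<sigma> x = x)"
  then show "\<sigma> \<in> gal L K"
    using field_aut_hom(1,3)[OF L, of \<sigma>]
    by (auto simp: gal_def Bij_def field_aut_def Ring.ring_hom_def)
qed

lemma field_aut_restrict:
  assumes "type_subfield L" "field_aut L \<sigma>"
  shows "field_aut L (restrict \<sigma> L)"
  using assms type_subfield_closed(5,7)[OF assms(1)]
  by (auto simp: field_aut_def cong: bij_betw_cong)

lemma field_aut_comp:
  assumes "field_aut L \<sigma>" "field_aut L \<tau>"
  shows "field_aut L (\<sigma> \<circ> \<tau>)"
proof -
  have "\<tau> x \<in> L" if "x \<in> L" for x using assms(2) that by (auto simp: field_aut_def bij_betw_def)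
  then show ?thesis using assms bij_betw_trans[of \<tau> L L \<sigma> L] by (simp add: field_aut_def)
qed

lemma field_aut_inv_into:
  assumes L: "type_subfield L" and \<sigma>: "field_aut L \<sigma>"
  shows "field_aut L (inv_into L \<sigma>)"
proof -
  have bij: "bij_betw \<sigma> L L" using \<sigma> by (simp add: field_aut_def)
  note inv = bij_betw_inv_into_right[OF bij] bij_betw_inv_into_left[OF bij]
  note hom = field_aut_hom[OF L \<sigma>] and cl = type_subfield_closed[OF L]
  have mem: "inv_into L \<sigma> x \<in> L" if "x \<in> L" for x
    using bij_betw_inv_into[OF bij] that by (auto simp: bij_betw_def)
  have "inv_into L \<sigma> (x + y) = inv_into L \<sigma> x + inv_into L \<sigma> y"
    "inv_into L \<sigma> (x * y) = inv_into L \<sigma> x * inv_into L \<sigma> y" if "x \<in> L" "y \<in> L" for x y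
  proof -
    have "\<sigma> (inv_into L \<sigma> x + inv_into L \<sigma> y) = x + y"
      "\<sigma> (inv_into L \<sigma> x * inv_into L \<sigma> y) = x * y"
      using hom(4,5) mem that inv(1) by auto
    then show "inv_into L \<sigma> (x + y) = inv_into L \<sigma> x + inv_into L \<sigma> y"
      "inv_into L \<sigma> (x * y) = inv_into L \<sigma> x * inv_into L \<sigma> y"
      using inv(2)[OF cl(5)[OF mem[OF that(1)] mem[OF that(2)]]]
        inv(2)[OF cl(7)[OF mem[OF that(1)] mem[OF that(2)]]] by auto
  qed
  then show ?thesis using bij_betw_inv_into[OF bij] by (auto simp: field_aut_def)
qed

lemma restrict_in_gal:
  assumes L: "type_subfield L" "K \<subseteq> L" and \<sigma>: "field_aut L \<sigma>" "\<And>x. x \<in> K \<Longrightarrow> \<sigma> x = x"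
  shows "restrict \<sigma> L \<in> gal L K"
  using field_aut_restrict[OF L(1) \<sigma>(1)] L(2) \<sigma>(2) by (auto simp: gal_iff[OF L(1)])

lemma gal_comp:
  assumes L: "type_subfield L" "K \<subseteq> L" and "\<sigma> \<in> gal L K" "\<tau> \<in> gal L K"
  shows "compose L \<sigma> \<tau> \<in> gal L K"
proof -
  have "restrict (\<sigma> \<circ> \<tau>) L \<in> gal L K"
    using assms(3,4) by (intro restrict_in_gal[OF L] field_aut_comp) (auto simp: gal_iff[OF L(1)])
  then show ?thesis by (simp add: compose_def o_def)
qed

lemma group_gal_group:
  assumes L: "type_subfield L" "K \<subseteq> L"
  shows "group (gal_group L K)"
proof -
  interpret B: group "BijGroup L" by (rule group_BijGroup)
  have "subgroup (gal L K) (BijGroup L)"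
  proof (rule B.subgroupI)
    show "gal L K \<subseteq> carrier (BijGroup L)" by (auto simp: gal_def BijGroup_def)
    show "gal L K \<noteq> {}" using restrict_in_gal[OF L field_aut_id] by auto
    show "inv\<^bsub>BijGroup L\<^esub> \<sigma> \<in> gal L K" if \<sigma>: "\<sigma> \<in> gal L K" for \<sigma>
    proof -
      have B: "\<sigma> \<in> Bij L" using \<sigma> by (simp add: gal_def)
      have *: "field_aut L \<sigma>" "\<And>x. x \<in> K \<Longrightarrow> \<sigma> x = x" using \<sigma> by (auto simp: gal_iff[OF L(1)])
      have "inv_into L \<sigma> x = x" if "x \<in> K" for x
        using bij_betw_inv_into_left[of \<sigma> L L x] *(1) *(2)[OF that] that L(2) by (auto simp: field_aut_def)
      then show ?thesis
        unfolding inv_BijGroup[OF B] using restrict_in_gal[OF L field_aut_inv_into[OF L(1) *(1)]] by blast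
    qed
    show "\<sigma> \<otimes>\<^bsub>BijGroup L\<^esub> \<tau> \<in> gal L K" if "\<sigma> \<in> gal L K" "\<tau> \<in> gal L K" for \<sigma> \<tau>
      using gal_comp[OF L that] that by (simp add: BijGroup_def gal_def)
  qed
  then show ?thesis unfolding gal_group_def by (rule B.subgroup_imp_group)
qed

section \<open>Subfields cut out by an automorphism or by the Frobenius\<close>

lemma type_subfield_fixed:
  assumes L: "type_subfield L" and \<sigma>: "field_aut L \<sigma>"
  shows "type_subfield {x \<in> L. \<sigma> x = x}"
  using field_aut_hom[OF L \<sigma>] type_subfield_closed[OF L] by (intro type_subfieldI) auto

text \<open>Reduces perfectness of a generated field to the existence of \<open>p\<close>-th roots
  of its generators.\<close>

lemma type_subfield_frobenius_image:
  fixes L :: "'a::field set"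
  assumes p: "p = CHAR('a)" "Factorial_Ring.prime p" and L: "type_subfield L"
  shows "type_subfield {x \<in> L. \<exists>y\<in>L. y ^ p = x}"
proof (rule type_subfieldI)
  note cl = type_subfield_closed[OF L]
  show "1 \<in> {x \<in> L. \<exists>y\<in>L. y ^ p = x}" using cl(2) by (auto intro!: bexI[of _ 1])
  show "- x \<in> {x \<in> L. \<exists>y\<in>L. y ^ p = x}" if "x \<in> {x \<in> L. \<exists>y\<in>L. y ^ p = x}" for x
    using that cl(3) frobenius_minus[OF p] by (auto intro!: bexI[of _ "- y" for y])
  show "x + y \<in> {x \<in> L. \<exists>y\<in>L. y ^ p = x}"
    if "x \<in> {x \<in> L. \<exists>y\<in>L. y ^ p = x}" "y \<in> {x \<in> L. \<exists>y\<in>L. y ^ p = x}" for x y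
    using that cl(5) frobenius_add[OF p] by (auto intro!: bexI[of _ "u + w" for u w])
  show "x * y \<in> {x \<in> L. \<exists>y\<in>L. y ^ p = x}"
    if "x \<in> {x \<in> L. \<exists>y\<in>L. y ^ p = x}" "y \<in> {x \<in> L. \<exists>y\<in>L. y ^ p = x}" for x y
    using that cl(7) by (auto intro!: bexI[of _ "u * w" for u w] simp: power_mult_distrib)
  show "inverse x \<in> {x \<in> L. \<exists>y\<in>L. y ^ p = x}" if "x \<in> {x \<in> L. \<exists>y\<in>L. y ^ p = x}" for x
    using that cl(4) by (auto intro!: bexI[of _ "inverse u" for u] simp: power_inverse)
qed

section \<open>Artin-Schreier roots under automorphisms\<close>

lemma finite_artin_schreier_roots:
  fixes a :: "'a::field"
  assumes "n > 1"
  shows "finite {z. z ^ n - z = a}"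
proof -
  have "coeff (monom 1 n - [:a, 1:]) n = 1" using assms by (simp add: coeff_eq_0)
  then have nz: "monom 1 n - [:a, 1:] \<noteq> 0" by force
  show ?thesis
    by (rule finite_subset[OF _ poly_roots_finite[OF nz]]) (auto simp: poly_monom)
qed

text \<open>\<open>\<rho> x - x\<close> is a root of \<open>X\<^sup>p - X\<close>, hence lies in the prime field.\<close>
lemma field_aut_artin_schreier_difference:
  fixes L :: "'a::field set"
  assumes p: "p = CHAR('a)" "Factorial_Ring.prime p" and L: "type_subfield L" and \<rho>: "field_aut L \<rho>"
    and x: "x \<in> L" "\<rho> (x ^ p - x) = x ^ p - x"
  shows "\<exists>i. \<rho> x = x + of_nat i"
proof -
  note hom = field_aut_hom[OF L \<rho>] and cl = type_subfield_closed[OF L]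
  define e where "e = \<rho> x - x"
  have "e ^ p - e = 0"
    using x(2) hom(7)[OF cl(9)[OF x(1)] x(1), of p] hom(11)[OF x(1), of p]
    by (simp add: algebra_simps e_def frobenius_diff[OF p])
  \<comment> \<open>The term \<open>0 ^ p - 0\<close> matches the factorisation at
    \<open>x = 0\<close>, whose roots form the prime field.\<close>
  then have "poly (monom 1 p - [:0 ^ p - 0, 1:]) e = 0"
    using p prime_gt_0_nat by (simp add: poly_monom power_0_left)
  then have "poly (\<Prod>z\<in>(\<lambda>i. 0 + of_nat i) ` {..<p}. [:- z, 1:]) e = 0"
    unfolding artin_schreier_poly_eq_prod(1)[OF p] .
  then obtain i where "e = of_nat i" by (auto simp: poly_prod)
  then show ?thesis by (auto simp: e_def algebra_simps)
qed

lemma field_aut_of_nat: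
  assumes L: "type_subfield L" and \<sigma>: "field_aut L \<sigma>"
  shows "\<sigma> (of_nat n) = of_nat n"
  using field_aut_hom[OF L \<sigma>] type_subfield_closed(2,10)[OF L] by (induction n) auto

lemma field_aut_funpow:
  assumes "field_aut L \<sigma>"
  shows "field_aut L (\<sigma> ^^ n)"
proof (induction n)
  case (Suc n)
  then show ?case unfolding funpow.simps by (rule field_aut_comp[OF assms])
qed (use field_aut_id in \<open>simp add: id_def\<close>)

text \<open>The automorphism translates \<open>x\<close> by an integer, and \<open>p\<close> equal
  translations cancel.\<close>

lemma field_aut_artin_schreier_order:
  fixes L :: "'a::field set"
  assumes p: "p = CHAR('a)" "Factorial_Ring.prime p" and L: "type_subfield L" and \<rho>: "field_aut L \<rho>"
    and x: "x \<in> L" "\<rho> (x ^ p - x) = x ^ p - x"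
  shows "(\<rho> ^^ p) x = x"
proof -
  note hom = field_aut_hom[OF L \<rho>] and cl = type_subfield_closed[OF L]
  obtain i where i: "\<rho> x = x + of_nat i"
    using field_aut_artin_schreier_difference[OF p L \<rho> x] by blast
  have "(\<rho> ^^ j) x = x + of_nat (j * i)" for j
  proof (induction j)
    case (Suc j)
    then show ?case
      using hom(4)[OF x(1) cl(10)[of "j * i"]] field_aut_of_nat[OF L \<rho>, of "j * i"] i
      by (simp add: algebra_simps)
  qed simp
  then show ?thesis using p by simp
qed

subsection \<open>The tower over \<open>K\<close>\<close>

lemma hmonom_power: "hmonom c r ^ n = hmonom (c ^ n :: 'a::comm_ring_1) (of_nat n * r)"
proof (induction n)
  case 0
  then show ?case by (auto intro!: hahn_eqI simp: hcoeff_1 hcoeff_hmonom)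
next
  case (Suc n)
  then show ?case
    by (auto intro!: hahn_eqI simp: hcoeff_hmonom_mult hcoeff_hmonom algebra_simps)
qed

text \<open>An automorphism shifting \<alpha> by 1 has to shift \<theta> by a root of X^p - X - 1;
  this finds one among the constants.\<close>

lemma hconst_closed_artin_schreier:
  assumes "1 < n"
  shows "\<exists>c :: 'a::alg_closed_field. hconst c ^ n - hconst c = 1"
proof -
  have "coeff (monom 1 n - [:1, 1:] :: 'a poly) n = 1" using assms by (simp add: coeff_eq_0)
  then have "degree (monom 1 n - [:1, 1:] :: 'a poly) > 0"
    using assms le_degree[of "monom 1 n - [:1, 1:] :: 'a poly" n] by simp
  then obtain c :: 'a where "poly (monom 1 n - [:1, 1:]) c = 0"
    using alg_closed_imp_poly_has_root by blast
  then have "c ^ n - c = 1" by (simp add: poly_monom)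
  then have "hconst c ^ n - hconst c = 1"
    unfolding hmonom_power by (intro hahn_eqI) (simp add: hcoeff_hmonom hcoeff_1)
  then show ?thesis by blast
qed

lemma inverse_hvar: "inverse hvar = (hmonom 1 (-1) :: 'a::field hahn)"
proof (rule inverse_unique)
  show "hvar * hmonom 1 (-1) = (1 :: 'a hahn)"
    by (rule hahn_eqI) (simp add: hcoeff_hmonom_mult hcoeff_hmonom hcoeff_1)
qed

locale hahn_tower =
  fixes p :: nat and K N :: "'k::alg_closed_field hahn set" and \<alpha> \<theta> \<eta> :: "'k hahn"
  assumes p: "p = CHAR('k hahn)" "Factorial_Ring.prime p"
    and K: "type_subfield K"
    and K_gen: "generate_field ring_of_type_algebra (range hconst \<union> {hvar}) \<subseteq> K"
    and perfect: "perfect_subfield K"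
    and hensel: "henselian hval K"
    and nfl: "no_finite_limits K"
    and \<alpha>: "\<alpha> ^ p - \<alpha> = inverse hvar"
    and \<theta>: "\<theta> ^ p - \<theta> = \<alpha>"
    and \<eta>: "\<eta> ^ p - \<eta> = \<alpha>\<^sup>2"
    and N_def: "N = generate_field ring_of_type_algebra (K \<union> {\<theta>, \<eta>})"
begin

lemma p1: "1 < p"
  using p prime_gt_1_nat by blast

lemma K_mem: "range hconst \<subseteq> K" "hvar \<in> K" "inverse hvar \<in> K"
proof -
  have "range hconst \<union> {hvar} \<subseteq> K"
    using generate_field_type(2) K_gen by (rule subset_trans)
  then show *: "range hconst \<subseteq> K" "hvar \<in> K" by simp_all
  then show "inverse hvar \<in> K" using type_subfield_closed(4)[OF K] by blast
qed

lemma N: "type_subfield N" "K \<subseteq> N" "\<theta> \<in> N" "\<eta> \<in> N" "\<alpha> \<in> N"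
  and N_min: "\<And>E. type_subfield E \<Longrightarrow> K \<subseteq> E \<Longrightarrow> \<theta> \<in> E \<Longrightarrow> \<eta> \<in> E \<Longrightarrow> N \<subseteq> E"
proof -
  show 1: "type_subfield N" "K \<subseteq> N" "\<theta> \<in> N" "\<eta> \<in> N"
    using generate_field_type(1,2)[of "K \<union> {\<theta>, \<eta>}"] unfolding N_def by auto
  show "\<alpha> \<in> N" using type_subfield_closed(6)[OF 1(1) type_subfield_closed(9)[OF 1(1,3)] 1(3)] \<theta> by metis
  show "\<And>E. type_subfield E \<Longrightarrow> K \<subseteq> E \<Longrightarrow> \<theta> \<in> E \<Longrightarrow> \<eta> \<in> E \<Longrightarrow> N \<subseteq> E"
    unfolding N_def by (rule generate_field_type(3)) auto
qed

text \<open>The \<open>p\<close>-th power of t^(-1/p^(i+1)) is t^(-1/p^i). So subtracting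
  \<open>n\<close> terms leaves a root of X^p - X = t^(-1/p^n), whose value is that exponent divided
  by \<open>p\<close>.\<close>

lemma \<alpha>_root:
  "hval (\<alpha> - (\<Sum>i=1..n. hmonom 1 (- 1 / of_nat p ^ i))) = Fin (- 1 / of_nat p ^ Suc n)"
proof -
  let ?m = "\<lambda>i. hmonom 1 (- 1 / of_nat p ^ i) :: 'k hahn" and ?\<beta> = "\<lambda>n. \<alpha> - (\<Sum>i=1..n. hmonom 1 (- 1 / of_nat p ^ i))"
  have "?\<beta> n ^ p - ?\<beta> n = ?m n"
  proof (induction n)
    case 0
    then show ?case using \<alpha> by (simp add: inverse_hvar)
  next
    case (Suc n)
    have m: "?m (Suc n) ^ p = ?m n" using p1 by (simp add: hmonom_power)
    have \<beta>: "?\<beta> (Suc n) = ?\<beta> n - ?m (Suc n)" by simp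
    show ?case unfolding \<beta> frobenius_diff[OF p, of "?\<beta> n" "?m (Suc n)"] m using Suc by (simp add: algebra_simps)
  qed
  then show ?thesis
    using hval_artin_schreier_root[OF p1 _ hval_hmonom, of "?\<beta> n" 1 "- 1 / of_nat p ^ n"] p1
    by (simp add: mult.commute)
qed

text \<open>The exponents -1/p^(n+1) all occur in \<alpha> and accumulate at 0 from below, which
  contradicts \<open>no_finite_limits\<close> at the bound 0.\<close>

lemma \<alpha>_notin_K: "\<alpha> \<notin> K"
proof
  assume "\<alpha> \<in> K"
  then have fin: "finite {\<gamma>. real_of_rat \<gamma> < 0 \<and> hcoeff \<alpha> \<gamma> \<noteq> 0}"
    using nfl unfolding no_finite_limits_def by blast
  let ?e = "\<lambda>i. - 1 / of_nat p ^ i :: rat"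
  have inj: "(of_nat p ^ i :: rat) = of_nat p ^ j \<longleftrightarrow> i = j" for i j
    using p1 power_inject_exp[of "of_nat p :: rat"] by simp
  have "hcoeff \<alpha> (?e (Suc n)) \<noteq> 0" for n
  proof -
    \<comment> \<open>The terms already subtracted have other exponents, so the leading coefficient
      of the remainder is a coefficient of \<alpha>.\<close>
    have "hcoeff (\<Sum>i=1..m. hmonom 1 (?e i)) (?e (Suc n)) = (0 :: 'k)" if "m \<le> n" for m
      using that by (induction m) (simp_all add: hcoeff_hmonom inj del: power_Suc)
    then show ?thesis using hval_FinD[OF \<alpha>_root[of n]] by simp
  qed
  then have "range (\<lambda>n. ?e (Suc n)) \<subseteq> {\<gamma>. real_of_rat \<gamma> < 0 \<and> hcoeff \<alpha> \<gamma> \<noteq> 0}"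
    using p1 by (auto simp: of_rat_divide of_rat_minus of_rat_mult of_rat_power)
  then have "finite (range (\<lambda>n. ?e (Suc n)))" using fin finite_subset by blast
  moreover have "inj (\<lambda>n. ?e (Suc n))" by (intro injI) (simp add: inj del: power_Suc)
  ultimately show False using finite_imageD infinite_UNIV_nat by blast
qed

lemma hval_generators:
  "hval \<alpha> = Fin (- 1 / of_nat p)" "hval \<theta> = Fin (- 1 / of_nat p ^ 2)" "hval \<eta> = Fin (- 2 / of_nat p ^ 2)"
proof -
  note root = hval_artin_schreier_root[OF p1]
  show a: "hval \<alpha> = Fin (- 1 / of_nat p)" using \<alpha>_root[of 0] by simp
  show "hval \<theta> = Fin (- 1 / of_nat p ^ 2)"
    using root[OF \<theta> a] p1 by (simp add: power2_eq_square)
  have "hval (\<alpha>\<^sup>2) = Fin (- 2 / of_nat p)" using hval_power[OF a, of 2] by simp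
  then show "hval \<eta> = Fin (- 2 / of_nat p ^ 2)"
    using root[OF \<eta>] p1 by (simp add: power2_eq_square)
qed

text \<open>With a \<open>p\<close>-th root \<open>s\<close> of 1/t in \<open>K\<close>, the
  defining equations provide the roots: \<open>\<alpha> - s\<close> is a \<open>p\<close>-th root of
  \<alpha>, and subtracting it from \<theta>, or its square from \<eta>, gives \<open>p\<close>-th
  roots of these.\<close>

lemma N_perfect:
  assumes "x \<in> N"
  shows "\<exists>y\<in>N. y ^ p ^ n = x"
proof -
  let ?P = "{x \<in> N. \<exists>y\<in>N. y ^ p = x}"
  note cl = type_subfield_closed[OF N(1)]
  have K_root: "\<exists>y\<in>K. y ^ p = x" if "x \<in> K" for x
    using perfect that p p1 by (auto simp: perfect_subfield_def)
  obtain s where s: "s \<in> K" "s ^ p = inverse hvar" using K_root[OF K_mem(3)] by blast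
  then have "s \<in> N" using N by blast
  have \<alpha>': "(\<alpha> - s) ^ p = \<alpha>"
    using \<alpha> s(2) by (simp add: frobenius_diff[OF p] algebra_simps)
  have "(\<theta> - (\<alpha> - s)) ^ p = \<theta>"
    unfolding frobenius_diff[OF p, of \<theta>] \<alpha>' using \<theta> by (simp add: algebra_simps)
  moreover have "(\<eta> - (\<alpha> - s)\<^sup>2) ^ p = \<eta>"
  proof -
    have "((\<alpha> - s)\<^sup>2) ^ p = ((\<alpha> - s) ^ p)\<^sup>2" 
      by (simp add: power_mult[symmetric] mult.commute)
    then show ?thesis unfolding frobenius_diff[OF p, of \<eta>] \<alpha>' using \<eta> by (simp add: algebra_simps)
  qed
  moreover have "\<theta> - (\<alpha> - s) \<in> N" "\<eta> - (\<alpha> - s)\<^sup>2 \<in> N" using N \<open>s \<in> N\<close> by (auto intro!: cl)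
  ultimately have "\<theta> \<in> ?P" "\<eta> \<in> ?P" using N by blast+
  moreover have "K \<subseteq> ?P" using K_root N(2) by blast
  ultimately have sub: "N \<subseteq> ?P"
    using N_min type_subfield_frobenius_image[OF p N(1)] by blast
  show ?thesis
  proof (induction n)
    case 0
    then show ?case using assms by simp
  next
    case (Suc n)
    then obtain y where "y \<in> N" "y ^ p ^ n = x" by blast
    moreover from this obtain z where "z \<in> N" "z ^ p = y" using sub by blast
    ultimately show ?case by (intro bexI[of _ z]) (auto simp: power_mult)
  qed
qed

lemma fixed_generators_imp_fixed:
  assumes \<sigma>: "field_aut N \<sigma>" "\<And>x. x \<in> K \<Longrightarrow> \<sigma> x = x" "\<sigma> \<theta> = \<theta>" "\<sigma> \<eta> = \<eta>" and x: "x \<in> N"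
  shows "\<sigma> x = x"
  using N_min[OF type_subfield_fixed[OF N(1) \<sigma>(1)]] \<sigma> x N by auto

section \<open>Lower bound for the ideals of nontrivial automorphisms\<close>

lemma ideal_subset_ram_elem:
  assumes \<sigma>: "field_aut N \<sigma>" and y: "y \<in> N" "hval y = Fin q" "q < 0" "hval (\<sigma> y - y) = 0"
  shows "valuation_ideal hval N \<subseteq> ram_elem hval N \<sigma>"
proof
  fix c assume "c \<in> valuation_ideal hval N"
  then have c: "c \<in> N" "0 < hval c" by (auto simp: valuation_ideal_def)
  note hom = field_aut_hom[OF N(1) \<sigma>]
  have "\<exists>n. Fin (- q / of_nat (p ^ n)) \<le> hval c"
  proof (cases "c = 0")
    case False
    then obtain r where r: "hval c = Fin r" using hval_finite by blast
    then have "r > 0" using c by (simp add: zero_extended_def)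
    obtain n where n: "- q / r < of_nat n" using reals_Archimedean2 by blast
    have "(of_nat n :: rat) < of_nat (p ^ n)" using power_gt_expt[of p n] p1 by (simp only: of_nat_less_iff One_nat_def)
    then have "- q / r < of_nat (p ^ n)" using n by linarith
    then have "- q / of_nat (p ^ n) \<le> r" using \<open>r > 0\<close> p1 by (simp add: field_simps)
    then show ?thesis using r by (intro exI[of _ n]) simp
  qed simp
  then obtain n where n: "Fin (- q / of_nat (p ^ n)) \<le> hval c" by blast
  obtain z where z: "z \<in> N" "z ^ p ^ n = y" using N_perfect[OF y(1)] by blast
  have pn: "of_nat (p ^ n) > (0::rat)" using p1 by simp
  have z0: "z \<noteq> 0" using z y(2) p1 by (auto simp: power_0_left)
  then obtain s where s: "hval z = Fin s" using hval_finite by blast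
  have sq: "s = q / of_nat (p ^ n)" using hval_power[OF s, of "p ^ n"] z(2) y(2) pn by (simp add: field_simps)
  \<comment> \<open>Since \<sigma> commutes with the Frobenius, the numerator keeps value 0 while
    the pole order of the denominator is divided by p^n.\<close>
  have "(\<sigma> z - z) ^ p ^ n = \<sigma> y - y"
  proof -
    have "(\<sigma> z - z + z) ^ p ^ n = (\<sigma> z - z) ^ p ^ n + z ^ p ^ n"
      using p by (intro freshmans_dream') auto
    then show ?thesis using hom(11)[OF z(1), of "p ^ n"] z(2) by simp
  qed
  then have d: "hval ((\<sigma> z - z) ^ p ^ n) = Fin 0" using y(4) by (simp add: zero_extended_def)
  then have "\<sigma> z - z \<noteq> 0" using p1 by (auto simp: power_0_left)
  then obtain w where w: "hval (\<sigma> z - z) = Fin w" using hval_finite by blast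
  then have "w = 0" using hval_power[OF w, of "p ^ n"] d p1 by auto
  then have "hval ((\<sigma> z - z) / z) = Fin (- q / of_nat (p ^ n))" using hval_divide[OF w s] sq by simp
  then have "hval ((\<sigma> z - z) / z) \<le> hval c" using n by (simp only:)
  then show "c \<in> ram_elem hval N \<sigma>" unfolding ram_elem_def using c(1) z(1) z0 by blast
qed

lemma ideal_subset_ram_elem_gal:
  assumes \<sigma>: "\<sigma> \<in> gal N K" and x: "x \<in> N" "\<sigma> x \<noteq> x"
  shows "valuation_ideal hval N \<subseteq> ram_elem hval N \<sigma>"
proof -
  have aut: "field_aut N \<sigma>" and fx: "\<And>x. x \<in> K \<Longrightarrow> \<sigma> x = x"
    using \<sigma> by (auto simp: gal_iff[OF N(1)])
  note hom = field_aut_hom[OF N(1) aut]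
  have main: ?thesis
    if y: "y \<in> N" "hval y = Fin q" "q < 0" "\<sigma> (y ^ p - y) = y ^ p - y" "\<sigma> y \<noteq> y" for y q
  proof (rule ideal_subset_ram_elem[OF aut y(1-3)])
    obtain i where "\<sigma> y = y + of_nat i"
      using field_aut_artin_schreier_difference[OF p N(1) aut y(1,4)] by blast
    then have i: "\<sigma> y - y = of_nat i" "(of_nat i :: 'k hahn) \<noteq> 0" using y(5) by auto
    have "(of_nat i :: 'k) \<noteq> 0" using i(2) by (auto simp: of_nat_eq_0_iff_char_dvd)
    then show "hval (\<sigma> y - y) = 0" unfolding i(1) hval_eq_0_iff using hval_of_nat by (simp add: hcoeff_of_nat)
  qed
  \<comment> \<open>The first generator moved is taken so that \<sigma> fixes
    \<open>y ^ p - y\<close>, which is 1/t, \<alpha> or \<alpha>^2 in the three cases.\<close>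
  consider "\<sigma> \<alpha> \<noteq> \<alpha>" | "\<sigma> \<alpha> = \<alpha>" "\<sigma> \<theta> \<noteq> \<theta>" | "\<sigma> \<alpha> = \<alpha>" "\<sigma> \<eta> \<noteq> \<eta>"
    using fixed_generators_imp_fixed[OF aut fx _ _ x(1)] x(2) by blast
  then show ?thesis
  proof cases
    case 1
    then show ?thesis using main[OF N(5) hval_generators(1)] p1 fx[OF K_mem(3)] \<alpha> by simp
  next
    case 2
    then show ?thesis using main[OF N(3) hval_generators(2)] p1 \<theta> by simp
  next
    case 3
    then show ?thesis using main[OF N(4) hval_generators(3)] p1 \<eta> hom(11)[OF N(5), of 2] by simp
  qed
qed

section \<open>Exponent, finiteness and fixed field of the Galois group\<close>

lemma gal_order:
  assumes \<sigma>: "\<sigma> \<in> gal N K" and x: "x \<in> N"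
  shows "(\<sigma> ^^ (p ^ 3)) x = x"
proof -
  have aut: "field_aut N (\<sigma> ^^ n)" for n
    using \<sigma> by (intro field_aut_funpow) (auto simp: gal_iff[OF N(1)])
  have fx: "(\<sigma> ^^ n) x = x" if "x \<in> K" for x n
    using \<sigma> that by (induction n) (auto simp: gal_iff[OF N(1)])
  note step = field_aut_artin_schreier_order[OF p N(1) aut]
  have pw: "(\<sigma> ^^ n) ^^ p = \<sigma> ^^ (n * p)" for n by (simp add: funpow_mult mult.commute)
  have mult: "(\<sigma> ^^ (n * m)) x = x" if "(\<sigma> ^^ n) x = x" for n m x
  proof -
    have "((\<sigma> ^^ n) ^^ m) x = x" using that by (induction m) auto
    then show ?thesis by (simp add: funpow_mult mult.commute)
  qed
  have a: "(\<sigma> ^^ p) \<alpha> = \<alpha>"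
    using step[OF N(5), of 1] fx[OF K_mem(3), of 1] \<alpha> pw[of 1] by simp
  \<comment> \<open>Fixing \<alpha>, the iterate \<open>\<sigma> ^^ p\<close> fixes the right-hand
    sides of the equations of \<theta> and \<eta>, so its own \<open>p\<close>-th iterate fixes both
    roots.\<close>
  then have t: "(\<sigma> ^^ (p * p)) \<theta> = \<theta>" "(\<sigma> ^^ (p * p)) \<eta> = \<eta>"
    using step[OF N(3), of p] step[OF N(4), of p] \<theta> \<eta> pw[of p]
      field_aut_hom(11)[OF N(1) aut N(5), of p 2] by simp_all
  have "p ^ 3 = (p * p) * p" by (simp add: power3_eq_cube)
  then have "(\<sigma> ^^ (p ^ 3)) \<theta> = \<theta>" "(\<sigma> ^^ (p ^ 3)) \<eta> = \<eta>" using mult t by simp_all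
  then show ?thesis using fixed_generators_imp_fixed[OF aut fx _ _ x] by blast
qed

text \<open>An automorphism is determined by the images of \<theta> and \<eta>. These are
  Artin-Schreier roots over the image of \<alpha> or its square, and that image has finitely many
  possibilities.\<close>

lemma finite_gal: "finite (gal N K)"
proof -
  let ?R = "\<lambda>a :: 'k hahn. {z. z ^ p - z = a}"
  let ?A = "?R (inverse hvar)"
  have fin: "finite (?R a)" for a by (rule finite_artin_schreier_roots[OF p1])
  have "(\<lambda>\<sigma>. (\<sigma> \<theta>, \<sigma> \<eta>)) ` gal N K \<subseteq> (\<Union>w\<in>?A. ?R w) \<times> (\<Union>w\<in>?A. ?R (w\<^sup>2))"
  proof
    fix u assume "u \<in> (\<lambda>\<sigma>. (\<sigma> \<theta>, \<sigma> \<eta>)) ` gal N K"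
    then obtain \<sigma> where \<sigma>: "\<sigma> \<in> gal N K" "u = (\<sigma> \<theta>, \<sigma> \<eta>)" by blast
    then have aut: "field_aut N \<sigma>" and fx: "\<And>x. x \<in> K \<Longrightarrow> \<sigma> x = x" by (auto simp: gal_iff[OF N(1)])
    note hom = field_aut_hom[OF N(1) aut] and cl = type_subfield_closed[OF N(1)]
    have as: "\<sigma> z ^ p - \<sigma> z = \<sigma> (z ^ p - z)" if "z \<in> N" for z
      using hom(7)[OF cl(9)[OF that] that] hom(11)[OF that] by simp
    have "\<sigma> \<alpha> \<in> ?A" "\<sigma> \<theta> \<in> ?R (\<sigma> \<alpha>)" "\<sigma> \<eta> \<in> ?R ((\<sigma> \<alpha>)\<^sup>2)"
      using as[OF N(5)] as[OF N(3)] as[OF N(4)] \<alpha> \<theta> \<eta> fx[OF K_mem(3)] hom(11)[OF N(5), of 2] by auto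
    then show "u \<in> (\<Union>w\<in>?A. ?R w) \<times> (\<Union>w\<in>?A. ?R (w\<^sup>2))" using \<sigma>(2) by blast
  qed
  then have "finite ((\<lambda>\<sigma>. (\<sigma> \<theta>, \<sigma> \<eta>)) ` gal N K)" by (rule finite_subset) (use fin in blast)
  moreover have "inj_on (\<lambda>\<sigma>. (\<sigma> \<theta>, \<sigma> \<eta>)) (gal N K)"
  proof (rule inj_onI)
    fix \<sigma> \<tau> assume st: "\<sigma> \<in> gal N K" "\<tau> \<in> gal N K" "(\<sigma> \<theta>, \<sigma> \<eta>) = (\<tau> \<theta>, \<tau> \<eta>)"
    then have s: "field_aut N \<sigma>" "\<And>x. x \<in> K \<Longrightarrow> \<sigma> x = x" "\<sigma> \<in> extensional N"
      and t: "field_aut N \<tau>" "\<And>x. x \<in> K \<Longrightarrow> \<tau> x = x" "\<tau> \<in> extensional N"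
      by (auto simp: gal_iff[OF N(1)])
    have "type_subfield {x \<in> N. \<sigma> x = \<tau> x}"
      using field_aut_hom[OF N(1) s(1)] field_aut_hom[OF N(1) t(1)] type_subfield_closed[OF N(1)]
      by (intro type_subfieldI) auto
    then have "N \<subseteq> {x \<in> N. \<sigma> x = \<tau> x}" using N s t st(3) by (intro N_min) auto
    then show "\<sigma> = \<tau>" using s(3) t(3) by (intro extensionalityI[of _ N]) auto
  qed
  ultimately show ?thesis using finite_imageD by blast
qed

lemma tower:
  defines "K1 \<equiv> adjoin K \<alpha>"
  defines "K2 \<equiv> adjoin K1 \<theta>"
  shows "type_subfield K1" "K \<subseteq> K1" "\<alpha> \<in> K1" "type_subfield K2" "K1 \<subseteq> K2" "\<theta> \<in> K2" "adjoin K2 \<eta> = N"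
proof -
  have a: "\<alpha> ^ p - \<alpha> \<in> K" using \<alpha> K_mem by simp
  note A = adjoin_incl[OF p K a] adjoin_subfield[OF p K a]
  show 1: "type_subfield K1" "K \<subseteq> K1" "\<alpha> \<in> K1" using A by (auto simp: K1_def)
  have t: "\<theta> ^ p - \<theta> \<in> K1" using \<theta> 1 by simp
  note T = adjoin_incl[OF p 1(1) t] adjoin_subfield[OF p 1(1) t]
  show 2: "type_subfield K2" "K1 \<subseteq> K2" "\<theta> \<in> K2" using T by (auto simp: K2_def)
  have e: "\<eta> ^ p - \<eta> \<in> K2" using \<eta> 1 2 type_subfield_closed(9)[OF 2(1)] by auto
  note E = adjoin_incl[OF p 2(1) e] adjoin_subfield[OF p 2(1) e]
  show "adjoin K2 \<eta> = N"
  proof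
    have "K1 \<subseteq> N" unfolding K1_def by (rule adjoin_min[OF p K a N(1,2,5)])
    then have "K2 \<subseteq> N" unfolding K2_def by (rule adjoin_min[OF p 1(1) t N(1) _ N(3)])
    then show "adjoin K2 \<eta> \<subseteq> N" by (rule adjoin_min[OF p 2(1) e N(1) _ N(4)])
    show "N \<subseteq> adjoin K2 \<eta>" using E 1 2 by (intro N_min) auto
  qed
qed

text \<open>Descent of \<open>z\<close> along the tower: an automorphism of a layer that shifts its
  generator by 1 is lifted to \<open>N\<close>. As the lift fixes \<open>z\<close>, the element
  falls into the next smaller field. The case splits treat a trivial layer separately; the lowest
  one is proper by \<open>\<alpha>_notin_K\<close>.\<close>

lemma gal_fixed:
  assumes z: "z \<in> N" and fx: "\<And>\<sigma>. \<sigma> \<in> gal N K \<Longrightarrow> \<sigma> z = z"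
  shows "z \<in> K"
proof -
  define K1 where "K1 = adjoin K \<alpha>"
  define K2 where "K2 = adjoin K1 \<theta>"
  note tower = tower[folded K1_def, folded K2_def]
  note K1 = tower(1) and K2 = tower(4)
  have a: "\<alpha> ^ p - \<alpha> \<in> K" using \<alpha> K_mem by simp
  have t: "\<theta> ^ p - \<theta> \<in> K1" using \<theta> tower by simp
  have a2: "\<alpha> \<in> K2" "\<alpha>\<^sup>2 \<in> K2" using tower type_subfield_closed(9)[OF K2] by auto
  then have e: "\<eta> ^ p - \<eta> \<in> K2" using \<eta> by simp
  have z_fixed: "\<sigma> z = z" if "field_aut N \<sigma>" "\<And>x. x \<in> K \<Longrightarrow> \<sigma> x = x" for \<sigma>
    using fx[OF restrict_in_gal[OF N(1,2) that]] z by simp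
  note ext1 = artin_schreier_extend[OF p K a, folded K1_def]
  note ext2 = artin_schreier_extend[OF p K1 t, folded K2_def]
  note ext3 = artin_schreier_extend[OF p K2 e, unfolded tower(7)]
  have "z \<in> K2"
  proof (cases "\<eta> \<in> K2")
    case True
    then show ?thesis using z adjoin_eq_self[OF p K2 e True] tower(7) by simp
  next
    case False
    have d: "1 \<in> K2" "1 ^ p - 1 = (\<eta> ^ p - \<eta>) - (\<eta> ^ p - \<eta>)" using type_subfield_closed[OF K2] by auto
    obtain \<sigma> where \<sigma>: "field_aut N \<sigma>" "\<And>y. y \<in> K2 \<Longrightarrow> \<sigma> y = y" "\<eta> \<notin> K2 \<Longrightarrow> \<sigma> \<eta> = \<eta> + 1"
      using ext3[OF field_aut_id d] by blast
    then have "\<sigma> z = z" using z_fixed tower by blast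
    then show ?thesis
      using artin_schreier_fixed[OF p K2 e False, unfolded tower(7), OF \<sigma>(1,2)] \<sigma>(3) False z by blast
  qed
  have "z \<in> K1"
  proof (cases "\<theta> \<in> K1")
    case True
    then show ?thesis using \<open>z \<in> K2\<close> adjoin_eq_self[OF p K1 t True] K2_def by simp
  next
    case False
    have d: "1 \<in> K1" "1 ^ p - 1 = (\<theta> ^ p - \<theta>) - (\<theta> ^ p - \<theta>)" using type_subfield_closed[OF K1] by auto
    obtain \<sigma> where \<sigma>: "field_aut K2 \<sigma>" "\<And>y. y \<in> K1 \<Longrightarrow> \<sigma> y = y" "\<theta> \<notin> K1 \<Longrightarrow> \<sigma> \<theta> = \<theta> + 1"
      using ext2[OF field_aut_id d] by blast
    have "\<sigma> (\<alpha>\<^sup>2) = \<alpha>\<^sup>2" using \<sigma>(2) tower(1,3) type_subfield_closed(9) by blast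
    \<comment> \<open>As \<sigma> fixes \<alpha>^2, the lift may use the shift 0 for \<eta>.\<close>
    then have d': "0 \<in> K2" "0 ^ p - 0 = \<sigma> (\<eta> ^ p - \<eta>) - (\<eta> ^ p - \<eta>)"
      using type_subfield_closed[OF K2] p1 \<eta> by (auto simp: power_0_left)
    obtain \<tau> where \<tau>: "field_aut N \<tau>" "\<And>y. y \<in> K2 \<Longrightarrow> \<tau> y = \<sigma> y" using ext3[OF \<sigma>(1) d'] by blast
    have "\<tau> x = x" if "x \<in> K" for x using \<tau>(2)[of x] \<sigma>(2)[of x] that tower(2,5) by (metis subsetD)
    then have "\<sigma> z = z" using z_fixed[OF \<tau>(1)] \<tau>(2)[OF \<open>z \<in> K2\<close>] by simp
    then show ?thesis
      using artin_schreier_fixed[OF p K1 t False, folded K2_def, OF \<sigma>(1,2)] \<sigma>(3) False \<open>z \<in> K2\<close> by blast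
  qed
  have d: "1 \<in> K" "1 ^ p - 1 = (\<alpha> ^ p - \<alpha>) - (\<alpha> ^ p - \<alpha>)" using type_subfield_closed[OF K] by auto
  obtain \<sigma> where \<sigma>: "field_aut K1 \<sigma>" "\<And>y. y \<in> K \<Longrightarrow> \<sigma> y = y" "\<sigma> \<alpha> = \<alpha> + 1"
    using ext1[OF field_aut_id d] \<alpha>_notin_K by blast
  obtain c :: 'k where c: "hconst c ^ p - hconst c = 1" using hconst_closed_artin_schreier[OF p1] by blast
  have cK: "hconst c \<in> K" using K_mem by blast
  \<comment> \<open>Shifting \<alpha> by 1 moves the right-hand side of the equation of \<theta> by
    1, so \<theta> is to be shifted by \<open>hconst c\<close>.\<close>
  have "hconst c \<in> K1" "hconst c ^ p - hconst c = \<sigma> (\<theta> ^ p - \<theta>) - (\<theta> ^ p - \<theta>)"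
    using cK tower c \<theta> \<sigma>(3) by auto
  then obtain \<sigma>2 where \<sigma>2: "field_aut K2 \<sigma>2" "\<And>y. y \<in> K1 \<Longrightarrow> \<sigma>2 y = \<sigma> y"
    using ext2[OF \<sigma>(1)] by blast
  have "2 * \<theta> + hconst c \<in> K2"
    using type_subfield_closed(10)[OF K2, of 2] cK tower by (auto intro!: type_subfield_closed(5,7)[OF K2])
  moreover have "(2 * \<theta> + hconst c) ^ p - (2 * \<theta> + hconst c) = \<sigma>2 (\<eta> ^ p - \<eta>) - (\<eta> ^ p - \<eta>)"
  proof -
    have two: "(2 :: 'k hahn) ^ p = 2" using frobenius_of_nat[OF p, of 2] by simp
    have "(2 * \<theta> + hconst c) ^ p - (2 * \<theta> + hconst c) = 2 * (\<theta> ^ p - \<theta>) + (hconst c ^ p - hconst c)"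
      by (simp add: frobenius_add[OF p] power_mult_distrib two algebra_simps)
    also have "\<dots> = (\<alpha> + 1)\<^sup>2 - \<alpha>\<^sup>2" unfolding \<theta> c by (simp add: power2_eq_square algebra_simps)
    also have "(\<alpha> + 1)\<^sup>2 = \<sigma>2 (\<alpha>\<^sup>2)"
      using field_aut_hom(11)[OF K2 \<sigma>2(1) a2(1), of 2] \<sigma>2(2)[OF tower(3)] \<sigma>(3) by simp
    finally show ?thesis using \<eta> by simp
  qed
  ultimately obtain \<tau> where \<tau>: "field_aut N \<tau>" "\<And>y. y \<in> K2 \<Longrightarrow> \<tau> y = \<sigma>2 y"
    using ext3[OF \<sigma>2(1)] by blast
  have \<tau>K1: "\<tau> y = \<sigma> y" if "y \<in> K1" for y using \<tau>(2)[of y] \<sigma>2(2)[OF that] that tower(5) by (metis subsetD)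
  have "\<tau> x = x" if "x \<in> K" for x using \<tau>K1[of x] \<sigma>(2)[OF that] that tower(2) by (metis subsetD)
  then have "\<sigma> z = z" using z_fixed[OF \<tau>(1)] \<tau>K1[OF \<open>z \<in> K1\<close>] by simp
  then show ?thesis
    using artin_schreier_fixed[OF p K a \<alpha>_notin_K, folded K1_def, OF \<sigma>] \<open>z \<in> K1\<close> by blast
qed

sublocale galois: hahn_galois N K "gal N K"
proof (rule hahn_galois.intro)
  show "finite ((\<lambda>\<sigma>. \<sigma> x) ` gal N K)" for x using finite_gal by simp
  show "\<exists>\<rho>\<in>gal N K. \<forall>x\<in>N. \<rho> x = x"
    using restrict_in_gal[OF N(1,2) field_aut_id] by (intro bexI[of _ "restrict (\<lambda>x. x) N"]) auto
  show "\<exists>\<rho>\<in>gal N K. \<forall>x\<in>N. \<rho> x = \<sigma> (\<tau> x)" if "\<sigma> \<in> gal N K" "\<tau> \<in> gal N K" for \<sigma> \<tau>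
    using gal_comp[OF N(1,2) that] by (intro bexI[of _ "compose N \<sigma> \<tau>"]) (auto simp: compose_eq)
  show "field_aut N \<sigma>" if "\<sigma> \<in> gal N K" for \<sigma> using that by (simp add: gal_iff[OF N(1)])
  show "\<sigma> x = x" if "\<sigma> \<in> gal N K" "x \<in> K" for \<sigma> x using that by (simp add: gal_iff[OF N(1)])
  show "x \<in> K" if "x \<in> N" "\<And>\<sigma>. \<sigma> \<in> gal N K \<Longrightarrow> \<sigma> x = x" for x using that by (rule gal_fixed)
qed (fact N K hensel K_mem)+

section \<open>Determination of the ramification ideals\<close>

lemma ram_elem_subset_ideal:
  assumes \<sigma>: "\<sigma> \<in> gal N K"
  shows "ram_elem hval N \<sigma> \<subseteq> valuation_ideal hval N"
proof
  fix c assume "c \<in> ram_elem hval N \<sigma>"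
  then obtain b where b: "b \<in> N" "b \<noteq> 0" "c \<in> N" "hval ((\<sigma> b - b) / b) \<le> hval c"
    by (auto simp: ram_elem_def)
  have "Factorial_Ring.prime CHAR('k)" using p by simp
  moreover have "(\<sigma> ^^ (CHAR('k) ^ 3)) x = x" if "x \<in> N" for x using gal_order[OF \<sigma> that] p by simp
  ultimately have "0 < hval ((\<sigma> b - b) / b)" using b by (intro galois.hval_conjugate_diff[OF \<sigma>]) auto
  then show "c \<in> valuation_ideal hval N" using b by (simp add: valuation_ideal_def)
qed

lemma ramification_ideals_eq: "ramification_ideals hval N K = {valuation_ideal hval N}"
proof -
  let ?M = "valuation_ideal hval N" and ?\<Gamma> = "gal_group N K"
  interpret \<Gamma>: group ?\<Gamma> by (rule group_gal_group[OF N(1,2)])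
  have car: "carrier ?\<Gamma> = gal N K" and one: "\<one>\<^bsub>?\<Gamma>\<^esub> = (\<lambda>x\<in>N. x)"
    by (simp_all add: gal_group_def BijGroup_def)
  have eq: "ram_subgroup hval N H = ?M" if H: "subgroup H ?\<Gamma>" "H \<noteq> {\<one>\<^bsub>?\<Gamma>\<^esub>}" for H
  proof
    have sub: "H \<subseteq> gal N K" using subgroup.subset[OF H(1)] car by simp
    then show "ram_subgroup hval N H \<subseteq> ?M" using ram_elem_subset_ideal by (auto simp: ram_subgroup_def)
    obtain \<sigma> where \<sigma>: "\<sigma> \<in> H" "\<sigma> \<noteq> \<one>\<^bsub>?\<Gamma>\<^esub>" using subgroup.one_closed[OF H(1)] H(2) by blast
    have "\<sigma> \<in> extensional N" using \<sigma>(1) sub by (auto simp: gal_iff[OF N(1)])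
    then obtain x where "x \<in> N" "\<sigma> x \<noteq> x"
      using \<sigma>(2) extensionalityI[of \<sigma> N "\<lambda>x\<in>N. x"] unfolding one by fastforce
    then show "?M \<subseteq> ram_subgroup hval N H"
      using ideal_subset_ram_elem_gal[of \<sigma> x] \<sigma>(1) sub unfolding ram_subgroup_def by blast
  qed
  \<comment> \<open>A trivial group would fix \<alpha> and put it into \<open>K\<close>. So the
    whole group is an admissible \<open>H\<close>, and the ideal does occur.\<close>
  have "gal N K \<noteq> {\<one>\<^bsub>?\<Gamma>\<^esub>}" using gal_fixed[OF N(5)] \<alpha>_notin_K N(5) one by auto
  then have "Ram hval N K = {?M}"
    using eq \<Gamma>.subgroup_self unfolding Ram_def car by blast
  then show ?thesis by (auto simp: ramification_ideals_def)
qed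

end

theorem proposition6p17:
  fixes K N :: "'p::prime_card mod_ring alg_closure hahn set"
    and \<alpha> \<theta> \<eta> :: "'p mod_ring alg_closure hahn"
  assumes "CARD('p) > 2"
    and "subfield K ring_of_type_algebra"
    and "generate_field ring_of_type_algebra (range hconst \<union> {hvar}) \<subseteq> K"
    and "perfect_subfield K"
    and "henselian hval K"
    and "no_finite_limits K"
    and "\<alpha> ^ CARD('p) - \<alpha> = inverse hvar"
    and "\<theta> ^ CARD('p) - \<theta> = \<alpha>"
    and "\<eta> ^ CARD('p) - \<eta> = \<alpha>\<^sup>2"
    and "N = generate_field ring_of_type_algebra (K \<union> {\<theta>, \<eta>})"
  shows "ramification_ideals hval N K = {valuation_ideal hval N}"
proof -
  have "hahn_tower CARD('p) K N \<alpha> \<theta> \<eta>"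
  proof (rule hahn_tower.intro)
    show "CARD('p) = CHAR('p mod_ring alg_closure hahn)" by simp
    show "Factorial_Ring.prime CARD('p)" by (rule prime_card)
  qed (fact assms)+
  then show ?thesis by (rule hahn_tower.ramification_ideals_eq)
qed

end
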